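(* Let $b>1$ be an integer, let $L:[0,1)^2\to\mathbb{S}^2$ be the Lambert cylindrical equal-area projection, and let $\mathscr{Z}$ be the set of all sequences $L(S^\boxplus_{b,2})=(L(q_0),L(q_1),\dots)$, where $S^\boxplus_{b,2}=(q_0,q_1,\dots)$ runs through all $S^\Box_{b,2}$-guided sequences. Then there is a constant $C'=C'(b)$ such that for every $Z\in\mathscr{Z}$ and every $N\in\mathbb{N}$ with $b^2$-adic expansion $N=\sum_{j=0}^n\epsilon_jb^{2j}$ ($\epsilon_j\in\{0,\dots,b^2-1\}$, $\epsilon_n\ne0$), $$\mathcal{D}_\infty(Z_N)\ \le\ \frac{2+3\sqrt2}{N}\min\Big\{\sum_{j=0}^n\epsilon_jb^j,\ b^{n+1}(b+2)-\sum_{j=0}^n\epsilon_jb^j\Big\}+\frac{C'}{N}\log(N)\ \le\ \frac{2+3\sqrt2}{2}\,\frac{b(b+2)}{\sqrt N}+\frac{C'}{N}\log(N).$$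
   Context: $\mathbb{N}=\{1,2,\dots\}$. $\mathbb{S}^2\subset\mathbb{R}^3$ is the unit sphere, $\mu$ its normalized surface measure. **Lambert projection.** $L(x,y)=\big(2\sqrt{y-y^2}\cos(2\pi x),\,2\sqrt{y-y^2}\sin(2\pi x),\,1-2y\big)$ for $(x,y)\in[0,1)^2$. **$L^\infty$-discrepancy (spherical cap discrepancy).** For a multiset $X=\{x_1,\dots,x_N\}$ in $\mathbb{S}^2$, $\mathcal{D}_\infty(X)=\frac1N\sup_A\big|\sum_{j=1}^N\chi_A(x_j)-N\mu(A)\big|$, where $\chi_A$ is the indicator function of $A$ and the supremum is over all spherical caps, i.e. metric balls $A=\{x\in\mathbb{S}^2: \mathrm{dist}(w,x)\le t\}$ with $w\in\mathbb{S}^2$ and $t\in(0,r)$, $r$ the diameter of $\mathbb{S}^2$. $Z_N$ denotes the multiset of the first $N$ elements of $Z$. **$S^\Box_{b,2}$-sequences.** Fix an enumeration $\{H_1,\dots,H_{b^2-1}\}=\{0,\dots,b-1\}^2\setminus\{\vec0\}$ and a sequence $\pi_0,\pi_1,\dots$ of permutations of $\{1,\dots,b^2-1\}$. Define recursively $s_0=\vec0$ and, once $s_0,\dots,s_{b^{2m}-1}$ are defined ($m\ge0$), $s_{k\cdot b^{2m}+i}=b^{-m-1}H_{\pi_m(k)}+s_i$ for $1\le k\le b^2-1$, $0\le i<b^{2m}$. Any sequence in $[0,1)^2$ obtained this way is an $S^\Box_{b,2}$-sequence. **Guided sequences.** Given an $S^\Box_{b,2}$-sequence $(s_0,s_1,\dots)$,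 a sequence $(q_0,q_1,\dots)$ in $[0,1)^2$ is $S^\Box_{b,2}$-guided if $q_0$ is arbitrary and for every integer $m\ge0$: (i) for all $v\in(b^{-m-1}\mathbb{Z}^2)\cap[0,1)^2$, $|\{q_0,\dots,q_{b^{2(m+1)}-1}\}\cap(b^{-(m+1)}[0,1)^2+v)|=1$; (ii) for every $0\le r<b^{2m}$ and $1\le k<b^2$, $q_{r+k\cdot b^{2m}}\in s_r+b^{-m}[0,1)^2$. The set $\mathscr{Z}$ uses guided sequences for all choices of $S^\Box_{b,2}$. *)

theory Defs
  imports "HOL-Analysis.Analysis" "HOL-Combinatorics.Permutations" "HOL-Library.Multiset"
begin

(* The normalized surface measure of the unit sphere, given by the polar-coordinate description of
   surface measure: the mass of A is vol {x. 0 < |x| < 1, x/|x| in A} / vol (unit ball).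
   It is a Borel measure on the ambient space concentrated on the sphere; the lemmas below
   record the formula, the mass 1 of the sphere, and the invariance under orthogonal maps,
   which determine it uniquely. *)
definition sphere_measure :: "(real^3) measure" where
  "sphere_measure = distr (uniform_measure lborel (ball 0 1)) borel (\<lambda>x. x /\<^sub>R norm x)"

lemma sphere_measure_sets [simp]: "sets sphere_measure = sets borel"
  by (simp add: sphere_measure_def)

lemma measure_sphere_measure:
  assumes "A \<in> sets borel"
  shows "measure sphere_measure A =
    measure lborel {x \<in> ball 0 1. x /\<^sub>R norm x \<in> A} / measure lborel (ball (0 :: real^3) 1)"
proof -
  have [measurable]: "A \<in> sets borel" by fact
  have pos: "emeasure lborel (ball (0 :: real^3) 1) \<noteq> 0"
    using content_ball_pos[of 1 "0 :: real^3"] by (auto simp: measure_def)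
  have fin: "emeasure lborel (ball (0 :: real^3) 1) \<noteq> \<infinity>"
    using emeasure_lborel_ball_finite[of "0 :: real^3" 1] by auto
  have "measure sphere_measure A =
    measure (uniform_measure lborel (ball 0 1)) ((\<lambda>x. x /\<^sub>R norm x) -` A)"
    by (simp add: sphere_measure_def measure_distr)
  also have "\<dots> = measure lborel (ball 0 1 \<inter> (\<lambda>x. x /\<^sub>R norm x) -` A)
    / measure lborel (ball (0 :: real^3) 1)"
    by (rule measure_uniform_measure[OF pos fin])
      (use measurable_sets_borel[OF _ \<open>A \<in> sets borel\<close>, of "\<lambda>x. x /\<^sub>R norm x"] in simp)
  also have "ball 0 1 \<inter> (\<lambda>x. x /\<^sub>R norm x) -` A = {x \<in> ball 0 1. x /\<^sub>R norm x \<in> A}"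
    by auto
  finally show ?thesis .
qed

lemma measure_sphere_measure_sphere: "measure sphere_measure (sphere 0 1) = 1"
proof -
  have eq: "{x \<in> ball 0 1. x /\<^sub>R norm x \<in> sphere 0 1} = ball (0 :: real^3) 1 - {0}"
    by (auto simp: field_simps)
  have "measure lborel (ball (0 :: real^3) 1 - {0}) = measure lborel (ball (0 :: real^3) 1)"
    using emeasure_lborel_ball_finite[of "0 :: real^3" 1]
    by (subst measure_Diff) (auto simp: measure_def)
  moreover have "measure lborel (ball (0 :: real^3) 1) \<noteq> 0"
    using content_ball_pos[of 1 "0 :: real^3"] by auto
  ultimately show ?thesis
    by (subst measure_sphere_measure, simp add: borel_closed) (simp only: eq, simp)
qed

lemma measure_sphere_measure_orthogonal:
  assumes T: "orthogonal_transformation T" and A: "A \<in> sets borel"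
  shows "measure sphere_measure (T ` A) = measure sphere_measure A"
proof -
  have [measurable]: "A \<in> sets borel" by fact
  obtain S where S: "orthogonal_transformation S" "\<And>x. S (T x) = x" "\<And>x. T (S x) = x"
    using orthogonal_transformation_inv[OF T] orthogonal_transformation_bij[OF T]
    by (metis bij_inv_eq_iff)
  have lin: "linear T" "linear S"
    using T S(1) by (auto simp: orthogonal_transformation_def)
  have img: "T ` B = S -` B" for B
    using S(2,3) by (auto simp: image_iff) metis
  have TA: "T ` A \<in> sets borel"
    unfolding img using measurable_sets_borel[OF _ A, of S] lin(2)
    by (simp add: borel_measurable_continuous_onI linear_continuous_on linear_conv_bounded_linear)
  have nS: "norm (S x) = norm x" for x
    using S(1) by (simp add: orthogonal_transformation_norm)
  have *: "{x \<in> ball 0 1. x /\<^sub>R norm x \<in> T ` A} = T ` {x \<in> ball 0 1. x /\<^sub>R norm x \<in> A}"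
    unfolding img using lin(2) by (auto simp: nS linear_scale)
  have m: "{x \<in> ball 0 1. x /\<^sub>R norm x \<in> B} \<in> sets borel" if "B \<in> sets borel" for B :: "(real^3) set"
    using that by measurable
  have "measure lborel (T ` {x \<in> ball 0 1. x /\<^sub>R norm x \<in> A})
    = measure lebesgue (T ` {x \<in> ball 0 1. x /\<^sub>R norm x \<in> A})"
    using m[OF TA] unfolding * by (simp add: measure_completion)
  also have "\<dots> = measure lebesgue {x \<in> ball 0 1. x /\<^sub>R norm x \<in> A}"
    using T m[OF A]
    by (intro measure_orthogonal_image fmeasurableI2[OF lmeasurable_ball[of 0 1]]) auto
  finally show ?thesis
    using m[OF A] by (simp only: measure_sphere_measure[OF TA] measure_sphere_measure[OF A] *) simp
qed

definition spherical_caps :: "(real^3) set set" where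
  "spherical_caps = {{x \<in> sphere 0 1. dist w x \<le> t} | w t.
     w \<in> sphere 0 1 \<and> 0 < t \<and> t < diameter (sphere (0 :: real^3) 1)}"

definition cap_discrepancy :: "(real^3) multiset \<Rightarrow> real" where
  "cap_discrepancy X = 1 / real (size X) *
     (SUP A\<in>spherical_caps.
        \<bar>(\<Sum>x\<in>#X. indicator A x) - real (size X) * measure sphere_measure A\<bar>)"

definition initial_mset :: "(nat \<Rightarrow> 'a) \<Rightarrow> nat \<Rightarrow> 'a multiset" where
  "initial_mset Z N = image_mset Z (mset_set {..<N})"

definition lambert :: "real \<times> real \<Rightarrow> real^3" where
  "lambert = (\<lambda>(x, y). vector [2 * sqrt (y - y\<^sup>2) * cos (2 * pi * x),
                               2 * sqrt (y - y\<^sup>2) * sin (2 * pi * x),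
                               1 - 2 * y])"

definition unit_square :: "(real \<times> real) set" where
  "unit_square = {0..<1} \<times> {0..<1}"

(* the cell v + b^(-m) [0,1)^2 *)
definition cell :: "nat \<Rightarrow> nat \<Rightarrow> real \<times> real \<Rightarrow> (real \<times> real) set" where
  "cell b m v = (\<lambda>u. v + (1 / real b ^ m) *\<^sub>R u) ` unit_square"

(* (b^(-m) Z^2) \<inter> [0,1)^2 *)
definition grid :: "nat \<Rightarrow> nat \<Rightarrow> (real \<times> real) set" where
  "grid b m = {(1 / real b ^ m) *\<^sub>R (of_int i, of_int j) | i j. True} \<inter> unit_square"

definition digit_vectors :: "nat \<Rightarrow> (real \<times> real) set" where
  "digit_vectors b = {(real i, real j) | i j. i < b \<and> j < b}"

definition box_sequence :: "nat \<Rightarrow> (nat \<Rightarrow> real \<times> real) \<Rightarrow> bool" where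
  "box_sequence b s \<longleftrightarrow>
     (\<exists>(H :: nat \<Rightarrow> real \<times> real) (p :: nat \<Rightarrow> nat \<Rightarrow> nat).
        bij_betw H {1..b\<^sup>2 - 1} (digit_vectors b - {0}) \<and>
        (\<forall>m. p m permutes {1..b\<^sup>2 - 1}) \<and>
        s 0 = 0 \<and>
        (\<forall>m. \<forall>k\<in>{1..b\<^sup>2 - 1}. \<forall>i<b ^ (2 * m).
           s (k * b ^ (2 * m) + i) = (1 / real b ^ (m + 1)) *\<^sub>R H (p m k) + s i))"

definition guided_by :: "nat \<Rightarrow> (nat \<Rightarrow> real \<times> real) \<Rightarrow> (nat \<Rightarrow> real \<times> real) \<Rightarrow> bool" where
  "guided_by b s q \<longleftrightarrow>
     (\<forall>n. q n \<in> unit_square) \<and>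
     (\<forall>m. (\<forall>v\<in>grid b (m + 1). card (q ` {..<b ^ (2 * (m + 1))} \<inter> cell b (m + 1) v) = 1) \<and>
          (\<forall>r<b ^ (2 * m). \<forall>k. 1 \<le> k \<and> k < b\<^sup>2 \<longrightarrow> q (r + k * b ^ (2 * m)) \<in> cell b m (s r)))"

definition lambert_guided_sequences :: "nat \<Rightarrow> (nat \<Rightarrow> real^3) set" where
  "lambert_guided_sequences b =
     {lambert \<circ> q | q. \<exists>s. box_sequence b s \<and> guided_by b s q}"

end

theory Submission
  imports Defs
begin

text \<open>
  Let \<open>n = b ^ m\<close> and divide the unit square into \<open>n\<^sup>2\<close> half-open square tiles. The recursion behind
  a guided sequence makes any \<open>n\<^sup>2\<close> consecutive points that start at a multiple of \<open>n\<^sup>2\<close>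
  visit every tile exactly once (\<open>guided_block_hits_tile\<close>). Lambert's map carries area on the square
  to normalized area on the sphere (\<open>card_tiles_le_measure\<close>), so for a cap \<open>A\<close> a tile inside the preimage
  \<open>S\<close> of \<open>A\<close> contributes one point and area \<open>1 / n\<^sup>2\<close>, a tile outside \<open>S\<close> contributes neither, and
  the error over such a block is at most the number of tiles that \<open>S\<close> cuts.

  The heart of the proof is that \<open>S\<close> cuts at most \<open>4 n\<close> tiles (\<open>card_split_tiles_le\<close>). Write a point of
  the sphere as \<open>L(x,y)\<close>; its inner product with the centre of the cap has the form
  \<open>\<rho> sqrt (y - y\<^sup>2) cos (2 \<pi> x - \<phi>) + (1 - 2 y) h\<close> with \<open>\<rho> \<ge> 0\<close>. Two features of this expression
  suffice. For fixed \<open>x\<close> it is concave or convex in \<open>y\<close>, so that a vertical line meets \<open>S\<close> or its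
  complement in an interval, and at most two of the \<open>n\<close> left tile edges on that line are cut. For fixed \<open>y\<close>
  it is a nondecreasing function of the same cosine, so that the slices of \<open>S\<close> at different heights are nested
  arcs; this leaves room in each row for at most one cut tile whose left edge lies in \<open>S\<close> and one whose
  left edge misses \<open>S\<close>. Together these are at most \<open>2 n + 2 n\<close> tiles.

  Now let \<open>n\<close> be the position of the leading digit of \<open>N\<close> in base \<open>b\<^sup>2\<close>. The first \<open>N\<close> indices consist of \<open>\<epsilon>\<^sub>j\<close> aligned blocks of length
  \<open>b ^ (2 j)\<close> for each \<open>j\<close>, which gives the error bound \<open>4 \<Sum> \<epsilon>\<^sub>j b ^ j\<close>. The other term of the minimum
  arises from completing \<open>N\<close> to \<open>b ^ (2 n + 2)\<close>: the missing indices form \<open>b\<^sup>2 - 1 - \<epsilon>\<^sub>j\<close> blocks for each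
  \<open>j\<close> and one further index. Finally \<open>4 \<le> 2 + 3 sqrt 2\<close>, and the explicit bound in \<open>N\<close> follows because
  the minimum of two numbers is at most their average and \<open>b ^ (2 n) \<le> N\<close>.
\<close>

section \<open>Tiles cut by a planar set\<close>

definition tile :: "nat \<Rightarrow> nat \<Rightarrow> nat \<Rightarrow> (real \<times> real) set" where
  "tile n i j = {real i / n..<real (i + 1) / n} \<times> {real j / n..<real (j + 1) / n}"

lemma mem_tile_iff:
  assumes "n > 0"
  shows "(x, y) \<in> tile n i j \<longleftrightarrow> \<lfloor>n * x\<rfloor> = int i \<and> \<lfloor>n * y\<rfloor> = int j"
  using assms by (auto simp: tile_def floor_eq_iff field_simps)

lemma tile_disjoint:
  assumes "n > 0" "p \<in> tile n i j" "p \<in> tile n i' j'"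
  shows "i = i' \<and> j = j'"
  using assms by (cases p) (auto simp: mem_tile_iff)

lemma subdivision_interval_subset:
  assumes "k < n"
  shows "{real k / n..<real (k + 1) / n} \<subseteq> {0..<1}"
proof -
  have "0 \<le> real k / n" "real (k + 1) / n \<le> 1"
    using assms by simp_all
  then show ?thesis
    by (auto simp del: of_nat_add)
qed

lemma tile_subset_unit_square:
  assumes "i < n" "j < n"
  shows "tile n i j \<subseteq> unit_square"
  unfolding tile_def unit_square_def
  using subdivision_interval_subset assms by (intro Sigma_mono) auto

definition splits :: "'a set \<Rightarrow> 'a set \<Rightarrow> bool" where
  "splits S E \<longleftrightarrow> \<not> E \<subseteq> S \<and> \<not> E \<subseteq> - S"

lemma splits_uminus [simp]: "splits (- S) E \<longleftrightarrow> splits S E"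
  by (auto simp: splits_def)

lemma card_le_two_if_no_three_increasing:
  fixes A :: "nat set"
  assumes "finite A" "\<And>a b c. a \<in> A \<Longrightarrow> b \<in> A \<Longrightarrow> c \<in> A \<Longrightarrow> a < b \<Longrightarrow> b < c \<Longrightarrow> False"
  shows "card A \<le> 2"
proof (cases "A = {}")
  case False
  have "A \<subseteq> {Min A, Max A}"
  proof
    fix x assume x: "x \<in> A"
    show "x \<in> {Min A, Max A}"
      using assms(2)[OF Min_in[OF assms(1) False] x Max_in[OF assms(1) False]]
        Min_le[OF assms(1) x] Max_ge[OF assms(1) x] by fastforce
  qed
  then have "card A \<le> card {Min A, Max A}"
    by (intro card_mono) auto
  also have "\<dots> \<le> 2"
    by (simp add: card_insert_if)
  finally show ?thesis .
qed simp

text \<open>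
  If three subdivision intervals were cut by an interval \<open>Y\<close>, the middle one would lie between points of
  \<open>Y\<close> from the outer two and hence inside \<open>Y\<close>. Cutting \<open>Y\<close> and cutting its complement are the same,
  which covers the second alternative.
\<close>

lemma card_split_intervals_le_two:
  fixes Y :: "real set"
  assumes "is_interval Y \<or> is_interval ({0..<1} - Y)"
  shows "card {j. j < n \<and> splits Y {real j / n..<real (j + 1) / n}} \<le> 2"
proof -
  have main: "card {j. j < n \<and> splits Y {real j / n..<real (j + 1) / n}} \<le> 2"
    if "is_interval (Y \<inter> {0..<1})" for Y :: "real set"
  proof (rule card_le_two_if_no_three_increasing)
    fix a b c
    assume a: "a \<in> {j. j < n \<and> splits Y {real j / n..<real (j + 1) / n}}"
      and b: "b \<in> {j. j < n \<and> splits Y {real j / n..<real (j + 1) / n}}"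
      and c: "c \<in> {j. j < n \<and> splits Y {real j / n..<real (j + 1) / n}}"
      and less: "a < b" "b < c"
    obtain u where u: "u \<in> Y" "real a / n \<le> u" "u < real (a + 1) / n"
      using a by (auto simp: splits_def)
    obtain v where v: "v \<notin> Y" "real b / n \<le> v" "v < real (b + 1) / n"
      using b by (auto simp: splits_def)
    obtain w where w: "w \<in> Y" "real c / n \<le> w" "w < real (c + 1) / n"
      using c by (auto simp: splits_def)
    have "real (a + 1) / n \<le> real b / n" "real (b + 1) / n \<le> real c / n"
      using less by (auto simp: divide_right_mono)
    moreover have "u \<in> {0..<1}" "w \<in> {0..<1}"
      using a c u w subsetD[OF subdivision_interval_subset[of a n], of u]
        subsetD[OF subdivision_interval_subset[of c n], of w] by auto
    ultimately have "u \<in> Y \<inter> {0..<1}" "w \<in> Y \<inter> {0..<1}" "u \<le> v" "v \<le> w"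
      using u v w by auto
    then have "v \<in> Y \<inter> {0..<1}"
      using \<open>is_interval (Y \<inter> {0..<1})\<close> unfolding is_interval_1 by blast
    then show False
      using v by blast
  qed simp
  show ?thesis
    using assms
  proof
    assume "is_interval Y"
    then have "is_interval (Y \<inter> {0..<1})"
      by (rule is_interval_Int[OF _ is_interval_co])
    then show ?thesis
      by (rule main)
  next
    assume "is_interval ({0..<1} - Y)"
    moreover have "- Y \<inter> {0..<1} = {0..<1} - Y"
      by blast
    ultimately show ?thesis
      using main[of "- Y"] by simp
  qed
qed

text \<open>
  A crossing pattern in a horizontal strip: going around the circle of abscissae one meets the set, its
  complement, the set and its complement again. The two points outside the set may lie at different
  heights \<open>y\<close> and \<open>y'\<close>, but \<open>a\<close> and \<open>c\<close> are in the set at both heights. Nested arcs as slices exclude this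
  pattern, both for the set and for its complement.
\<close>

definition alternates :: "(real \<times> real) set \<Rightarrow> bool" where
  "alternates S \<longleftrightarrow> (\<exists>a b c d y y'. 0 \<le> a \<and> a < b \<and> b < c \<and> c < d \<and> d < 1 \<and>
     y \<in> {0..<1} \<and> y' \<in> {0..<1} \<and> {a, c} \<times> {y, y'} \<subseteq> S \<and> (b, y) \<notin> S \<and> (d, y') \<notin> S)"

text \<open>
  Two such tiles in the same row, with their left edges inside \<open>S\<close> and a point outside \<open>S\<close> in each, would
  exhibit the alternation inside, outside, inside, outside.
\<close>

lemma card_split_tiles_with_edge_inside_le_one:
  assumes "\<not> alternates S" "j < n"
  shows "card {i. i < n \<and> \<not> tile n i j \<subseteq> S \<and> {real i / n} \<times> {real j / n..<real (j + 1) / n} \<subseteq> S} \<le> 1"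
    (is "card ?I \<le> 1")
proof -
  have False if i: "i \<in> ?I" "i' \<in> ?I" "i < i'" for i i'
  proof -
    obtain b y where b: "(b, y) \<in> tile n i j" "(b, y) \<notin> S"
      using i by auto
    obtain d y' where d: "(d, y') \<in> tile n i' j" "(d, y') \<notin> S"
      using i by auto
    define a c where "a = real i / n" and "c = real i' / n"
    have edges: "{a, c} \<times> {y, y'} \<subseteq> S"
      using i b(1) d(1) by (auto simp: tile_def a_def c_def)
    have "real (i + 1) / n \<le> c" "0 \<le> a"
      using i by (auto simp: divide_right_mono a_def c_def)
    moreover have "a \<le> b" "b < real (i + 1) / n" "c \<le> d"
      using b d by (auto simp: tile_def a_def c_def)
    moreover have "a \<noteq> b" "c \<noteq> d"
      using b d edges by auto
    moreover have "d < 1" "y \<in> {0..<1}" "y' \<in> {0..<1}"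
      using b(1) d(1) tile_subset_unit_square[of i n j] tile_subset_unit_square[of i' n j] i assms(2)
      by (auto simp: unit_square_def)
    ultimately have "0 \<le> a \<and> a < b \<and> b < c \<and> c < d \<and> d < 1 \<and> y \<in> {0..<1} \<and> y' \<in> {0..<1}"
      by linarith
    then have "alternates S"
      unfolding alternates_def using edges b(2) d(2) by blast
    then show False
      using assms(1) by blast
  qed
  then have "i = i'" if "i \<in> ?I" "i' \<in> ?I" for i i'
    using that by (metis (no_types, lifting) linorder_neqE_nat)
  then show ?thesis
    by (subst One_nat_def, subst card_le_Suc0_iff_eq) auto
qed

text \<open>
  A tile that is cut either has its left edge inside \<open>S\<close>, or outside \<open>S\<close>, or has a cut left edge. The
  first two kinds are counted along rows, at most one of each kind per row; the third kind is counted along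
  the vertical lines, at most two per line.
\<close>

lemma card_split_tiles_le:
  assumes "\<not> alternates S" "\<not> alternates (- S)"
    and "\<And>x. x \<in> {0..<1} \<Longrightarrow> is_interval {y \<in> {0..<1}. (x, y) \<in> S} \<or> is_interval {y \<in> {0..<1}. (x, y) \<notin> S}"
  shows "card {(i, j) \<in> {..<n} \<times> {..<n}. splits S (tile n i j)} \<le> 4 * n"
proof -
  let ?edge = "\<lambda>i j. {real i / n} \<times> {real j / n..<real (j + 1) / n}"
  let ?in = "\<lambda>S j. {i. i < n \<and> \<not> tile n i j \<subseteq> S \<and> ?edge i j \<subseteq> S}"
  let ?E = "\<lambda>i. {j. j < n \<and> splits S (?edge i j)}"
  have E: "card (?E i) \<le> 2" if "i < n" for i
  proof -
    let ?x = "real i / n"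
    have x: "?x \<in> {0..<1}"
      using that by auto
    have "{0..<1} - {y \<in> {0..<1}. (?x, y) \<in> S} = {y \<in> {0..<1}. (?x, y) \<notin> S}"
      by auto
    then have *: "is_interval {y \<in> {0..<1}. (?x, y) \<in> S} \<or> is_interval ({0..<1} - {y \<in> {0..<1}. (?x, y) \<in> S})"
      using assms(3)[OF x] by simp
    have "splits S (?edge i j) \<longleftrightarrow> splits {y \<in> {0..<1}. (?x, y) \<in> S} {real j / n..<real (j + 1) / n}"
      if "j < n" for j
    proof -
      have "{real j / n..<real (j + 1) / n} \<subseteq> {0..<1}"
        using that by (rule subdivision_interval_subset)
      then show ?thesis
        unfolding splits_def by blast
    qed
    then have "?E i = {j. j < n \<and> splits {y \<in> {0..<1}. (?x, y) \<in> S} {real j / n..<real (j + 1) / n}}"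
      by blast
    then show ?thesis
      using card_split_intervals_le_two[OF *, of n] by simp
  qed
  have "{(i, j) \<in> {..<n} \<times> {..<n}. splits S (tile n i j)} \<subseteq>
    (\<lambda>(j, i). (i, j)) ` (SIGMA j:{..<n}. ?in S j \<union> ?in (- S) j) \<union> (SIGMA i:{..<n}. ?E i)"
  proof
    fix p assume "p \<in> {(i, j) \<in> {..<n} \<times> {..<n}. splits S (tile n i j)}"
    then obtain i j where p: "p = (i, j)" "i < n" "j < n" and split: "splits S (tile n i j)"
      by auto
    consider "i \<in> ?in S j" | "i \<in> ?in (- S) j" | "j \<in> ?E i"
      using p split unfolding splits_def by blast
    then show "p \<in> (\<lambda>(j, i). (i, j)) ` (SIGMA j:{..<n}. ?in S j \<union> ?in (- S) j) \<union> (SIGMA i:{..<n}. ?E i)"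
      by cases (use p in \<open>auto intro!: image_eqI[of _ _ "(j, i)"]\<close>)
  qed
  then have "card {(i, j) \<in> {..<n} \<times> {..<n}. splits S (tile n i j)} \<le>
    card ((\<lambda>(j, i). (i, j)) ` (SIGMA j:{..<n}. ?in S j \<union> ?in (- S) j) \<union> (SIGMA i:{..<n}. ?E i))"
    by (intro card_mono finite_UnI finite_imageI finite_SigmaI) auto
  also have "\<dots> \<le> card (SIGMA j:{..<n}. ?in S j \<union> ?in (- S) j) + card (SIGMA i:{..<n}. ?E i)"
    by (intro order_trans[OF card_Un_le] add_right_mono card_image_le finite_SigmaI) auto
  also have "\<dots> = (\<Sum>j<n. card (?in S j \<union> ?in (- S) j)) + (\<Sum>i<n. card (?E i))"
    by simp
  also have "\<dots> \<le> (\<Sum>j<n. 2) + (\<Sum>i<n. 2)"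
  proof (intro add_mono sum_mono)
    fix j assume "j \<in> {..<n}"
    then have "card (?in S j) \<le> 1" "card (?in (- S) j) \<le> 1"
      using assms(1,2) by (intro card_split_tiles_with_edge_inside_le_one; simp)+
    then show "card (?in S j \<union> ?in (- S) j) \<le> 2"
      using card_Un_le[of "?in S j" "?in (- S) j"] by linarith
  qed (use E in auto)
  finally show ?thesis
    by simp
qed

section \<open>Preimages of half-spaces under the Lambert projection\<close>

definition halfspace_preimage :: "real^3 \<Rightarrow> real \<Rightarrow> (real \<times> real) set" where
  "halfspace_preimage w c = {p. c \<le> w \<bullet> lambert p}"

lemma cos_diff_sign:
  fixes a b :: real
  assumes "a < b" "b < a + 2 * pi"
  shows "cos b < cos a \<longleftrightarrow> 0 < sin ((a + b) / 2)" "cos a < cos b \<longleftrightarrow> sin ((a + b) / 2) < 0"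
proof -
  have "0 < sin ((b - a) / 2)"
    using assms by (intro sin_gt_zero) auto
  moreover have "cos a - cos b = 2 * (sin ((a + b) / 2) * sin ((b - a) / 2))"
    by (simp add: cos_diff_cos)
  ultimately have "0 < cos a - cos b \<longleftrightarrow> 0 < sin ((a + b) / 2)" "cos a - cos b < 0 \<longleftrightarrow> sin ((a + b) / 2) < 0"
    by (simp_all only: zero_less_mult_iff mult_less_0_iff) auto
  then show "cos b < cos a \<longleftrightarrow> 0 < sin ((a + b) / 2)" "cos a < cos b \<longleftrightarrow> sin ((a + b) / 2) < 0"
    by linarith+
qed

text \<open>
  Three sign changes of the sine would force three zeros, which span at least \<open>2 \<pi>\<close>. The proof shifts \<open>p\<close>
  into \<open>[0, 2 \<pi>)\<close> and pushes the points \<open>q\<close>, \<open>r\<close>, \<open>s\<close> successively past \<open>\<pi>\<close> and \<open>2 \<pi>\<close>.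
\<close>

lemma sin_not_alternating:
  fixes p q r s :: real
  assumes "p < q" "q < r" "r < s" "s < p + 2 * pi"
    and "0 < sin p" "sin q < 0" "0 < sin r" "sin s < 0"
  shows False
proof -
  define k where "k = \<lfloor>p / (2 * pi)\<rfloor>"
  define t where "t = 2 * pi * of_int k"
  have sin: "sin (x - t) = sin x" for x
    by (simp add: t_def sin_diff cos_int_2pin sin_int_2pin)
  have "of_int k \<le> p / (2 * pi)" "p / (2 * pi) < of_int k + 1"
    unfolding k_def by linarith+
  then have p: "0 \<le> p - t" "p - t < 2 * pi"
    by (simp_all add: t_def field_simps)
  have "p - t < pi"
    using p sin_le_zero[of "p - t"] sin[of p] assms(5) by fastforce
  then have "pi < q - t"
    using p assms sin_ge_zero[of "q - t"] sin[of q] by fastforce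
  then have r: "2 * pi \<le> r - t"
    using assms sin_le_zero[of "r - t"] sin[of r] by fastforce
  have "0 \<le> sin (s - t - 2 * pi)"
    using assms r \<open>p - t < pi\<close> by (intro sin_ge_zero) auto
  then show False
    using sin[of s] assms(8) by (simp add: sin_diff)
qed

text \<open>
  Superlevel sets of the cosine are arcs of the circle, so its values at four points in cyclic order cannot
  be alternately above and below a threshold. Comparing neighbouring values amounts to the sign of the sine
  at the midpoints, with \<open>a + 2 \<pi>\<close> serving as the neighbour of \<open>d\<close>.
\<close>

lemma cos_not_alternating:
  fixes a b c d :: real
  assumes "a < b" "b < c" "c < d" "d < a + 2 * pi"
    and "cos b < cos a" "cos b < cos c" "cos d < cos c" "cos d < cos a"
  shows False
proof (rule sin_not_alternating)
  show "0 < sin ((a + b) / 2)" "sin ((b + c) / 2) < 0" "0 < sin ((c + d) / 2)"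
    "sin ((d + (a + 2 * pi)) / 2) < 0"
    using assms cos_diff_sign[of a b] cos_diff_sign[of b c] cos_diff_sign[of c d]
      cos_diff_sign[of d "a + 2 * pi"] by auto
qed (use assms in \<open>simp_all add: add_divide_distrib\<close>)

text \<open>
  Polar coordinates for the equatorial part of \<open>w\<close>. That the amplitude \<open>r\<close> is nonnegative is essential:
  it makes the inner product depend on the cosine in the same direction at every height.
\<close>

lemma inner_lambert_eq:
  obtains r \<phi> where "r \<ge> 0"
    "\<And>x y. w \<bullet> lambert (x, y) = 2 * r * sqrt (y - y\<^sup>2) * cos (2 * pi * x - \<phi>) + (1 - 2 * y) * w $ 3"
proof -
  obtain r \<phi> where "w $ 1 = r * cos \<phi>" "w $ 2 = r * sin \<phi>" "r \<ge> 0"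
  proof -
    have "Complex (w $ 1) (w $ 2) = rcis (cmod (Complex (w $ 1) (w $ 2))) (Arg (Complex (w $ 1) (w $ 2)))"
      by (simp add: rcis_cmod_Arg)
    then show ?thesis
      using that[of "cmod (Complex (w $ 1) (w $ 2))" "Arg (Complex (w $ 1) (w $ 2))"]
      by (simp add: complex_eq_iff)
  qed
  then show ?thesis
    by (intro that[of r \<phi>]) (simp_all add: lambert_def inner_vec_def sum_3 cos_diff algebra_simps)
qed

text \<open>
  At a fixed height the coefficient of the cosine is nonnegative, so a point inside has a strictly larger
  cosine than a point outside. An alternation would therefore be an alternation of the cosine; for the
  complement the four points are read from \<open>b\<close> to \<open>a + 2 \<pi>\<close>.
\<close>

lemma halfspace_preimage_not_alternates:
  "\<not> alternates (halfspace_preimage w c)" "\<not> alternates (- halfspace_preimage w c)"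
proof -
  obtain r \<phi> where r: "r \<ge> 0" and L:
    "\<And>x y. w \<bullet> lambert (x, y) = 2 * r * sqrt (y - y\<^sup>2) * cos (2 * pi * x - \<phi>) + (1 - 2 * y) * w $ 3"
    using inner_lambert_eq[of w] by metis
  let ?S = "halfspace_preimage w c"
  have less: "cos (2 * pi * x' - \<phi>) < cos (2 * pi * x - \<phi>)"
    if "(x, y) \<in> ?S" "(x', y) \<notin> ?S" "y \<in> {0..<1}" for x x' y
  proof -
    have "0 \<le> 2 * r * sqrt (y - y\<^sup>2)"
      using r that(3) by (simp add: power2_eq_square mult_left_le)
    moreover have "2 * r * sqrt (y - y\<^sup>2) * cos (2 * pi * x' - \<phi>) < 2 * r * sqrt (y - y\<^sup>2) * cos (2 * pi * x - \<phi>)"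
      using that by (simp add: halfspace_preimage_def L)
    ultimately show ?thesis
      by (rule mult_left_less_imp_less[rotated])
  qed
  let ?t = "\<lambda>x. 2 * pi * x - \<phi>"
  have mono: "?t x < ?t x'" if "x < x'" for x x'
    using that by simp
  have wrap: "?t x' < ?t x + 2 * pi" if "x' < x + 1" for x x'
  proof -
    have "2 * pi * x' < 2 * pi * (x + 1)"
      using that by (intro mult_strict_left_mono) auto
    then show ?thesis
      by (simp add: algebra_simps)
  qed
  have period: "cos (?t x + 2 * pi) = cos (?t x)" for x
    by simp
  show "\<not> alternates ?S"
  proof
    assume "alternates ?S"
    then obtain a b c d y y' where *: "0 \<le> a" "a < b" "b < c" "c < d" "d < 1" "y \<in> {0..<1}" "y' \<in> {0..<1}"
      "{a, c} \<times> {y, y'} \<subseteq> ?S" "(b, y) \<notin> ?S" "(d, y') \<notin> ?S"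
      unfolding alternates_def by blast
    show False
    proof (rule cos_not_alternating)
      show "?t a < ?t b" "?t b < ?t c" "?t c < ?t d" "?t d < ?t a + 2 * pi"
        using mono[of a b] mono[of b c] mono[of c d] wrap[of d a] * by linarith+
      show "cos (?t b) < cos (?t a)" "cos (?t b) < cos (?t c)" "cos (?t d) < cos (?t c)" "cos (?t d) < cos (?t a)"
        using less[of a y b] less[of c y b] less[of c y' d] less[of a y' d] * by simp_all
    qed
  qed
  show "\<not> alternates (- ?S)"
  proof
    assume "alternates (- ?S)"
    then obtain a b c d y y' where *: "0 \<le> a" "a < b" "b < c" "c < d" "d < 1" "y \<in> {0..<1}" "y' \<in> {0..<1}"
      "{a, c} \<times> {y, y'} \<subseteq> - ?S" "(b, y) \<in> ?S" "(d, y') \<in> ?S"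
      unfolding alternates_def by blast
    show False
    proof (rule cos_not_alternating)
      show "?t b < ?t c" "?t c < ?t d" "?t d < ?t a + 2 * pi" "?t a + 2 * pi < ?t b + 2 * pi"
        using mono[of a b] mono[of b c] mono[of c d] wrap[of d a] * by linarith+
      have "cos (?t a) < cos (?t b)" "cos (?t a) < cos (?t d)"
        using less[of b y a] less[of d y' a] * by simp_all
      then show "cos (?t a + 2 * pi) < cos (?t b)" "cos (?t a + 2 * pi) < cos (?t d)"
        by (simp_all only: period)
      show "cos (?t c) < cos (?t b)" "cos (?t c) < cos (?t d)"
        using less[of b y c] less[of d y' c] * by simp_all
    qed
  qed
qed

text \<open>
  The graph is a semicircle. The inequality is Jensen's for the square root combined with Jensen's for
  \<open>y - y\<^sup>2\<close>; with \<open>A\<close> and \<open>B\<close> the values at \<open>a\<close> and \<open>b\<close>, the two gaps are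
  \<open>u v (A - B)\<^sup>2\<close> and \<open>u v (a - b)\<^sup>2\<close>.
\<close>

lemma concave_on_sqrt_parabola: "concave_on {0..1} (\<lambda>y :: real. sqrt (y - y\<^sup>2))"
  unfolding concave_on_iff
proof (intro conjI ballI allI impI)
  fix a b u v :: real
  assume a: "a \<in> {0..1}" and b: "b \<in> {0..1}" and uv: "0 \<le> u" "0 \<le> v" "u + v = 1"
  define A B where "A = sqrt (a - a\<^sup>2)" and "B = sqrt (b - b\<^sup>2)"
  have AB: "A\<^sup>2 = a - a\<^sup>2" "B\<^sup>2 = b - b\<^sup>2"
    using a b by (auto simp: A_def B_def power2_eq_square mult_left_le)
  have v: "v = 1 - u"
    using uv by simp
  have "(u * a + v * b) - (u * a + v * b)\<^sup>2 - (u * A + v * B)\<^sup>2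
      = u * (a - a\<^sup>2 - A\<^sup>2) + v * (b - b\<^sup>2 - B\<^sup>2) + u * v * ((a - b)\<^sup>2 + (A - B)\<^sup>2)"
    unfolding v by (simp add: power2_eq_square algebra_simps)
  also have "\<dots> \<ge> 0"
    using uv AB by simp
  finally have "u * A + v * B \<le> sqrt ((u * a + v * b) - (u * a + v * b)\<^sup>2)"
    by (intro real_le_rsqrt) simp
  then show "u * sqrt (a - a\<^sup>2) + v * sqrt (b - b\<^sup>2)
      \<le> sqrt (u *\<^sub>R a + v *\<^sub>R b - (u *\<^sub>R a + v *\<^sub>R b)\<^sup>2)"
    by (simp add: A_def B_def)
qed simp

lemma concave_on_ge_min:
  fixes f :: "real \<Rightarrow> real"
  assumes f: "concave_on I f" and ab: "a \<in> I" "b \<in> I" and y: "a \<le> y" "y \<le> b"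
  shows "min (f a) (f b) \<le> f y"
proof (cases "a = b")
  case False
  define u v where "u = (b - y) / (b - a)" and "v = 1 - u"
  have "u * (b - a) = b - y" "0 \<le> u" "u \<le> 1"
    using False y by (simp_all add: u_def)
  then have uv: "0 \<le> u" "0 \<le> v" "u + v = 1" "y = u *\<^sub>R a + v *\<^sub>R b"
    by (simp_all add: v_def algebra_simps)
  have "min (f a) (f b) = u * min (f a) (f b) + v * min (f a) (f b)"
    using uv(3) by (simp flip: distrib_right)
  also have "\<dots> \<le> u * f a + v * f b"
    using uv by (intro add_mono mult_left_mono) auto
  also have "\<dots> \<le> f y"
    using f ab uv unfolding concave_on_iff by blast
  finally show ?thesis .
qed (use y in auto)

text \<open>
  On a vertical line the inner product is \<open>u sqrt (y - y\<^sup>2)\<close> plus an affine function of \<open>y\<close>, where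
  \<open>u\<close> is a nonnegative multiple of the cosine. For \<open>u \<ge> 0\<close> it is concave and its superlevel sets are intervals;
  for \<open>u < 0\<close> it is convex and its sublevel sets are intervals.
\<close>

lemma halfspace_preimage_column:
  "is_interval {y \<in> {0..<1}. (x, y) \<in> halfspace_preimage w c} \<or>
   is_interval {y \<in> {0..<1}. (x, y) \<notin> halfspace_preimage w c}"
proof -
  obtain r \<phi> where r: "r \<ge> 0" and L:
    "\<And>x y. w \<bullet> lambert (x, y) = 2 * r * sqrt (y - y\<^sup>2) * cos (2 * pi * x - \<phi>) + (1 - 2 * y) * w $ 3"
    using inner_lambert_eq[of w] by metis
  define u where "u = 2 * r * cos (2 * pi * x - \<phi>)"
  define g where "g = (\<lambda>y. u * sqrt (y - y\<^sup>2) + (1 - 2 * y) * w $ 3)"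
  have mem: "(x, y) \<in> halfspace_preimage w c \<longleftrightarrow> c \<le> g y" for y
    by (simp add: halfspace_preimage_def L u_def g_def mult_ac)
  have concave: "concave_on {0..1} (\<lambda>y. u' * sqrt (y - y\<^sup>2) + (1 - 2 * y) * h)" if "0 \<le> u'" for u' h :: real
  proof (rule concave_on_add)
    show "concave_on {0..1} (\<lambda>y. u' * sqrt (y - y\<^sup>2))"
      using that concave_on_sqrt_parabola by (rule concave_on_cmul)
    show "concave_on {0..1} (\<lambda>y. (1 - 2 * y) * h)"
      unfolding concave_on_iff
    proof (intro conjI ballI allI impI)
      fix a b s t :: real assume "s + t = 1"
      then have t: "t = 1 - s"
        by simp
      show "s * ((1 - 2 * a) * h) + t * ((1 - 2 * b) * h) \<le> (1 - 2 * (s *\<^sub>R a + t *\<^sub>R b)) * h"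
        unfolding t by (simp add: algebra_simps)
    qed simp
  qed
  show ?thesis
  proof (cases "0 \<le> u")
    case True
    have "is_interval {y \<in> {0..<1}. (x, y) \<in> halfspace_preimage w c}"
      unfolding mem is_interval_1
    proof (intro ballI allI impI)
      fix a b y assume "a \<in> {y \<in> {0..<1}. c \<le> g y}" "b \<in> {y \<in> {0..<1}. c \<le> g y}" "a \<le> y \<and> y \<le> b"
      then show "y \<in> {y \<in> {0..<1}. c \<le> g y}"
        using concave_on_ge_min[OF concave[OF True, of "w $ 3"], of a b y] by (auto simp: g_def)
    qed
    then show ?thesis ..
  next
    case False
    then have "0 \<le> - u"
      by simp
    note concave = concave[OF this, of "- w $ 3"]
    have "is_interval {y \<in> {0..<1}. (x, y) \<notin> halfspace_preimage w c}"
      unfolding mem is_interval_1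
    proof (intro ballI allI impI)
      fix a b y assume "a \<in> {y \<in> {0..<1}. \<not> c \<le> g y}" "b \<in> {y \<in> {0..<1}. \<not> c \<le> g y}" "a \<le> y \<and> y \<le> b"
      then show "y \<in> {y \<in> {0..<1}. \<not> c \<le> g y}"
        using concave_on_ge_min[OF concave, of a b y] by (auto simp: g_def)
    qed
    then show ?thesis ..
  qed
qed

section \<open>The Lambert projection preserves area\<close>

text \<open>
  The surface measure is defined by volumes of cones in the unit ball, so equality of areas is an identity of
  volumes in space. Taking the cube root of the first coordinate as the radius makes the Jacobian
  determinant constant, hence volumes of images are found without integration.
\<close>

definition ball_chart :: "real^3 \<Rightarrow> real^3" where
  "ball_chart v = root 3 (v $ 1) *\<^sub>R lambert (v $ 2, v $ 3)"

text \<open>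
  The height \<open>0\<close> is excluded because the whole segment \<open>y = 0\<close> is mapped to the north pole, where
  injectivity and differentiability fail.
\<close>

definition chart_domain :: "(real^3) set" where
  "chart_domain = {v. 0 < v $ 1 \<and> v $ 1 < 1 \<and> 0 \<le> v $ 2 \<and> v $ 2 < 1 \<and> 0 < v $ 3 \<and> v $ 3 < 1}"

lemma norm_lambert:
  assumes "0 \<le> y" "y \<le> 1"
  shows "norm (lambert (x, y)) = 1"
proof -
  have pos: "0 \<le> y - y\<^sup>2"
    using assms by (simp add: power2_eq_square mult_left_le)
  have "(norm (lambert (x, y)))\<^sup>2 = (2 * sqrt (y - y\<^sup>2) * cos (2 * pi * x))\<^sup>2
      + (2 * sqrt (y - y\<^sup>2) * sin (2 * pi * x))\<^sup>2 + (1 - 2 * y)\<^sup>2"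
    by (simp add: lambert_def norm_eq_sqrt_inner inner_vec_def sum_3 flip: power2_eq_square)
  also have "\<dots> = 4 * (y - y\<^sup>2) + (1 - 2 * y)\<^sup>2"
    using pos by (simp add: power_mult_distrib cos_squared_eq algebra_simps)
  also have "\<dots> = 1"
    by (simp add: power2_eq_square algebra_simps)
  finally have "(norm (lambert (x, y)))\<^sup>2 = 1\<^sup>2"
    by simp
  then show ?thesis
    by (subst (asm) power2_eq_iff_nonneg) auto
qed

lemma inj_on_ball_chart: "inj_on ball_chart chart_domain"
proof (rule inj_onI)
  fix u v assume u: "u \<in> chart_domain" and v: "v \<in> chart_domain" and eq: "ball_chart u = ball_chart v"
  have nrm: "norm (ball_chart v) = root 3 (v $ 1)" if "v \<in> chart_domain" for v
    using that by (simp add: ball_chart_def chart_domain_def norm_lambert)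
  have 1: "u $ 1 = v $ 1"
    using nrm[OF u] nrm[OF v] eq by simp
  then have L: "lambert (u $ 2, u $ 3) = lambert (v $ 2, v $ 3)"
    using eq v by (simp add: ball_chart_def chart_domain_def)
  then have 3: "u $ 3 = v $ 3"
    by (auto simp: lambert_def vec_eq_iff forall_3)
  have "0 < v $ 3 - (v $ 3)\<^sup>2"
    using v by (simp add: chart_domain_def power2_eq_square)
  then have "sin (2 * pi * u $ 2) = sin (2 * pi * v $ 2) \<and> cos (2 * pi * u $ 2) = cos (2 * pi * v $ 2)"
    using L 3 by (auto simp: lambert_def vec_eq_iff forall_3)
  then obtain n :: int where "2 * pi * u $ 2 = 2 * pi * v $ 2 + 2 * pi * of_int n"
    unfolding sin_cos_eq_iff Ints_def by auto
  then have n: "u $ 2 = v $ 2 + of_int n"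
    by (metis distrib_left mult_cancel_left pi_neq_zero mult_eq_0_iff zero_neq_numeral)
  have "0 \<le> u $ 2" "u $ 2 < 1" "0 \<le> v $ 2" "v $ 2 < 1"
    using u v by (auto simp: chart_domain_def)
  then have "n = 0"
    using n by linarith
  then have 2: "u $ 2 = v $ 2"
    using n by simp
  show "u = v"
    using 1 2 3 by (simp add: vec_eq_iff forall_3)
qed

definition chart_jacobian :: "real^3 \<Rightarrow> real^3^3" where
  "chart_jacobian v =
    (let r = root 3 (v $ 1); r' = 1 / (3 * r\<^sup>2);
         s = 2 * sqrt (v $ 3 - (v $ 3)\<^sup>2); s' = 2 * (1 - 2 * v $ 3) / s;
         c = cos (2 * pi * v $ 2); d = sin (2 * pi * v $ 2) in
     vector [vector [r' * s * c, - (2 * pi * r * s * d), r * s' * c],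
             vector [r' * s * d, 2 * pi * r * s * c, r * s' * d],
             vector [r' * (1 - 2 * v $ 3), 0, - 2 * r]])"

text \<open>
  The determinant factors as \<open>- 4/3 \<pi>\<close> times \<open>c\<^sup>2 + d\<^sup>2\<close> times \<open>s\<^sup>2 + (1 - 2 y)\<^sup>2\<close>, where the last two
  factors are the squared lengths of unit vectors. The constant is the volume of the unit ball.
\<close>

lemma det_chart_jacobian:
  assumes "v \<in> chart_domain"
  shows "\<bar>det (chart_jacobian v)\<bar> = 4 / 3 * pi"
proof -
  define r where "r = root 3 (v $ 1)"
  define y where "y = v $ 3"
  define s where "s = 2 * sqrt (y - y\<^sup>2)"
  define c d where "c = cos (2 * pi * v $ 2)" and "d = sin (2 * pi * v $ 2)"
  have cd: "c\<^sup>2 + d\<^sup>2 = 1"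
    by (simp add: c_def d_def)
  have r: "r > 0"
    using assms by (simp add: r_def chart_domain_def)
  have y: "0 < y - y\<^sup>2"
    using assms by (simp add: y_def chart_domain_def power2_eq_square)
  have s: "s > 0" "s\<^sup>2 + (1 - 2 * y)\<^sup>2 = 1"
    using y by (simp_all add: s_def power_mult_distrib) (simp add: power2_eq_square algebra_simps)
  have "det (chart_jacobian v) = - (4 / 3 * pi) * ((c\<^sup>2 + d\<^sup>2) * (s\<^sup>2 + (1 - 2 * y)\<^sup>2))"
  proof -
    have J: "chart_jacobian v =
        vector [vector [1 / (3 * r\<^sup>2) * s * c, - (2 * pi * r * s * d), r * (2 * (1 - 2 * y) / s) * c],
                vector [1 / (3 * r\<^sup>2) * s * d, 2 * pi * r * s * c, r * (2 * (1 - 2 * y) / s) * d],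
                vector [1 / (3 * r\<^sup>2) * (1 - 2 * y), 0, - 2 * r]]"
      unfolding chart_jacobian_def Let_def by (simp only: r_def s_def y_def c_def d_def)
    show ?thesis
      unfolding J det_3 using r s(1) by (simp add: field_simps power2_eq_square)
  qed
  then show ?thesis
    using s cd by simp
qed

lemma ball_chart_has_derivative:
  assumes "v \<in> chart_domain"
  shows "(ball_chart has_derivative (*v) (chart_jacobian v)) (at v within S)"
proof -
  note [derivative_intros] = bounded_linear.has_derivative[OF bounded_linear_vec_nth]
  have v: "0 < v $ 1" "0 < v $ 3 - (v $ 3)\<^sup>2"
    using assms by (simp_all add: chart_domain_def power2_eq_square)
  define r where "r = root 3 (v $ 1)"
  define s where "s = 2 * sqrt (v $ 3 - (v $ 3)\<^sup>2)"
  define s' where "s' = 2 * (1 - 2 * v $ 3) / s"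
  define c d where "c = cos (2 * pi * v $ 2)" and "d = sin (2 * pi * v $ 2)"
  have R: "((\<lambda>x. root 3 (x $ 1)) has_derivative (\<lambda>h. 1 / (3 * r\<^sup>2) * h $ 1)) (at v within S)"
    by (rule has_derivative_eq_rhs[OF DERIV_compose_FDERIV[OF DERIV_real_root
            bounded_linear.has_derivative[OF bounded_linear_vec_nth has_derivative_ident]]])
      (use v in \<open>auto simp: r_def divide_simps\<close>)
  have S: "((\<lambda>x. 2 * sqrt (x $ 3 - (x $ 3)\<^sup>2)) has_derivative (\<lambda>h. s' * h $ 3)) (at v within S)"
    using v by (auto intro!: derivative_eq_intros simp: s'_def s_def field_simps)
  have C: "((\<lambda>x. cos (2 * pi * x $ 2)) has_derivative (\<lambda>h. - 2 * pi * d * h $ 2)) (at v within S)"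
    by (auto intro!: derivative_eq_intros simp: d_def)
  have D: "((\<lambda>x. sin (2 * pi * x $ 2)) has_derivative (\<lambda>h. 2 * pi * c * h $ 2)) (at v within S)"
    by (auto intro!: derivative_eq_intros simp: c_def)
  have J: "chart_jacobian v =
      vector [vector [1 / (3 * r\<^sup>2) * s * c, - (2 * pi * r * s * d), r * s' * c],
              vector [1 / (3 * r\<^sup>2) * s * d, 2 * pi * r * s * c, r * s' * d],
              vector [1 / (3 * r\<^sup>2) * (1 - 2 * v $ 3), 0, - 2 * r]]"
    unfolding chart_jacobian_def Let_def by (simp only: r_def s_def s'_def c_def d_def)
  have 1: "((\<lambda>x. ball_chart x $ 1) has_derivative (\<lambda>h. (chart_jacobian v *v h) $ 1)) (at v within S)"
    using has_derivative_mult[OF R has_derivative_mult[OF S C]]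
    by (auto simp: ball_chart_def lambert_def J matrix_vector_mult_def sum_3 simp flip: r_def s_def c_def d_def)
      (auto simp: algebra_simps)
  have 2: "((\<lambda>x. ball_chart x $ 2) has_derivative (\<lambda>h. (chart_jacobian v *v h) $ 2)) (at v within S)"
    using has_derivative_mult[OF R has_derivative_mult[OF S D]]
    by (auto simp: ball_chart_def lambert_def J matrix_vector_mult_def sum_3 simp flip: r_def s_def c_def d_def)
      (auto simp: algebra_simps)
  have 3: "((\<lambda>x. ball_chart x $ 3) has_derivative (\<lambda>h. (chart_jacobian v *v h) $ 3)) (at v within S)"
  proof -
    have "((\<lambda>x. 1 - 2 * x $ 3) has_derivative (\<lambda>h. - 2 * h $ 3)) (at v within S)"
      by (auto intro!: derivative_eq_intros)
    from has_derivative_mult[OF R this] show ?thesis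
      by (auto simp: ball_chart_def lambert_def J matrix_vector_mult_def sum_3 algebra_simps simp flip: r_def s_def c_def d_def)
  qed
  from 1 2 3 have "((\<lambda>x. ball_chart x $ i) has_derivative (\<lambda>h. (chart_jacobian v *v h) $ i))
      (at v within S)" for i
    using exhaust_3[of i] by auto
  then show ?thesis
    unfolding has_derivative_componentwise_within[of ball_chart]
    by (auto simp: Basis_vec_def inner_axis)
qed

text \<open>
  The set differs from an open box only on its faces, so its volume is squeezed between those of the open and
  the closed box.
\<close>

lemma measure_chart_domain_prod:
  assumes "0 \<le> a" "a < a'" "a' \<le> 1" "0 \<le> c" "c < c'" "c' \<le> 1"
  defines "X \<equiv> {v \<in> chart_domain. (v $ 2, v $ 3) \<in> {a..<a'} \<times> {c..<c'}}"
  shows "X \<in> lmeasurable" "measure lebesgue X = (a' - a) * (c' - c)"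
proof -
  let ?l = "vector [0, a, c] :: real^3" and ?u = "vector [1, a', c'] :: real^3"
  have sub: "box ?l ?u \<subseteq> X" "X \<subseteq> cbox ?l ?u"
    using assms(1-6) by (auto simp: X_def chart_domain_def mem_box_cart forall_3)
  have "X \<in> sets borel"
    unfolding X_def chart_domain_def mem_Times_iff by simp
  then show X: "X \<in> lmeasurable"
    by (intro fmeasurableI2[OF lmeasurable_cbox sub(2)]) simp
  have c: "measure lebesgue (cbox ?l ?u) = (a' - a) * (c' - c)"
  proof -
    have "cbox ?l ?u \<noteq> {}"
      using assms(1-6) by (auto simp: interval_ne_empty_cart forall_3)
    then have "measure lborel (cbox ?l ?u) = (\<Prod>i\<in>UNIV. ?u $ i - ?l $ i)"
      by (rule content_cbox_cart)
    also have "\<dots> = (a' - a) * (c' - c)"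
      unfolding UNIV_3 by simp
    finally show ?thesis
      by (subst measure_completion) simp_all
  qed
  have "measure lebesgue (box ?l ?u) = measure lebesgue (cbox ?l ?u)"
    by (simp add: measure_lborel_box_eq measure_lborel_cbox_eq)
  moreover have "measure lebesgue (box ?l ?u) \<le> measure lebesgue X"
    using sub X by (intro measure_mono_fmeasurable) auto
  moreover have "measure lebesgue X \<le> measure lebesgue (cbox ?l ?u)"
    using sub X by (intro measure_mono_fmeasurable) auto
  ultimately show "measure lebesgue X = (a' - a) * (c' - c)"
    using c by simp
qed

lemma measure_ball_chart_image:
  assumes "S \<in> lmeasurable" "S \<subseteq> chart_domain"
  shows "ball_chart ` S \<in> lmeasurable"
    and "measure lebesgue (ball_chart ` S) = 4 / 3 * pi * measure lebesgue S"
proof -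
  have det: "\<bar>det (matrix ((*v) (chart_jacobian v)))\<bar> = 4 / 3 * pi" if "v \<in> S" for v
    using that assms(2) det_chart_jacobian by auto
  have "((\<lambda>v. 1) has_integral measure lebesgue S) S"
    using assms(1) unfolding lmeasurable_iff_integrable_on lmeasure_integral[OF assms(1)]
    by (rule integrable_integral)
  from has_integral_mult_right[OF this, of "4 / 3 * pi"]
  have const: "((\<lambda>v. 4 / 3 * pi) has_integral 4 / 3 * pi * measure lebesgue S) S"
    by simp
  have int: "((\<lambda>v. \<bar>det (matrix ((*v) (chart_jacobian v)))\<bar>) has_integral
      4 / 3 * pi * measure lebesgue S) S"
    by (rule has_integral_eq[OF _ const]) (use det in auto)
  have S: "S \<in> sets lebesgue" and inj: "inj_on ball_chart S"
    using assms inj_on_ball_chart inj_on_subset by blast+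
  have der: "(ball_chart has_derivative (*v) (chart_jacobian v)) (at v within S)" if "v \<in> S" for v
    using that assms(2) ball_chart_has_derivative by blast
  show "ball_chart ` S \<in> lmeasurable"
    and "measure lebesgue (ball_chart ` S) = 4 / 3 * pi * measure lebesgue S"
    using has_measure_differentiable_image[OF S der inj] int by blast+
qed

text \<open>
  The chart maps \<open>S\<close> into the solid cone over \<open>A\<close>, and the Jacobian determinant of the chart cancels the
  volume \<open>4/3 \<pi>\<close> of the ball by which the surface measure is normalized.
\<close>

lemma measure_lambert_ge:
  assumes A: "A \<in> sets borel" and U: "lambert ` U \<subseteq> A"
    and S: "S \<in> lmeasurable" "S \<subseteq> {v \<in> chart_domain. (v $ 2, v $ 3) \<in> U}"
  shows "measure lebesgue S \<le> measure sphere_measure A"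
proof -
  have [measurable]: "A \<in> sets borel" by fact
  let ?B = "{x \<in> ball 0 1. x /\<^sub>R norm x \<in> A}"
  have B: "?B \<in> sets borel"
    by measurable
  have sub: "ball_chart ` S \<subseteq> ?B"
  proof (rule image_subsetI)
    fix v assume v: "v \<in> S"
    then have 1: "norm (lambert (v $ 2, v $ 3)) = 1" "0 < v $ 1" "v $ 1 < 1" "lambert (v $ 2, v $ 3) \<in> A"
      using S(2) U by (auto simp: chart_domain_def intro!: norm_lambert)
    then show "ball_chart v \<in> ?B"
      by (auto simp: ball_chart_def real_root_gt_zero)
  qed
  have "ball_chart ` S \<in> sets lebesgue"
    using measure_ball_chart_image(1)[OF S(1)] S(2) by (auto dest: fmeasurableD)
  then have "measure lebesgue (ball_chart ` S) \<le> measure lebesgue ?B"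
    using sub B by (intro measure_mono_fmeasurable fmeasurableI2[OF lmeasurable_ball[of 0 1]]) auto
  also have "measure lebesgue ?B = measure lborel ?B"
    using B by (simp add: measure_completion)
  finally have "4 / 3 * pi * measure lebesgue S \<le> measure lborel ?B"
    using S by (subst (asm) measure_ball_chart_image(2)) auto
  moreover have ball: "measure lborel (ball (0 :: real^3) 1) = 4 / 3 * pi"
    by (simp add: content_ball eval_unit_ball_vol)
  ultimately show ?thesis
    unfolding measure_sphere_measure[OF A] ball by (simp add: pos_le_divide_eq mult.commute)
qed

text \<open>
  Only this inequality is used: applied to a cap and to its complement in the sphere, it bounds the
  measure of the cap from both sides.
\<close>

lemma card_tiles_le_measure:
  assumes A: "A \<in> sets borel" and n: "n > 0" and T: "T \<subseteq> {..<n} \<times> {..<n}"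
    and sub: "\<And>i j. (i, j) \<in> T \<Longrightarrow> lambert ` tile n i j \<subseteq> A"
  shows "real (card T) \<le> (real n)\<^sup>2 * measure sphere_measure A"
proof -
  define X where "X = (\<lambda>(i, j). {v \<in> chart_domain. (v $ 2, v $ 3) \<in> tile n i j})"
  have X: "X t \<in> lmeasurable \<and> measure lebesgue (X t) = 1 / (real n)\<^sup>2" if "t \<in> T" for t
  proof -
    obtain i j where t: "t = (i, j)" "i < n" "j < n"
      using \<open>t \<in> T\<close> T by (cases t) auto
    have *: "0 \<le> real k / n" "real k / n < real (k + 1) / n" "real (k + 1) / n \<le> 1" if "k < n" for k
      using that by (simp_all add: field_simps)
    have "X t \<in> lmeasurable \<and> measure lebesgue (X t)
        = (real (i + 1) / n - real i / n) * (real (j + 1) / n - real j / n)"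
      unfolding X_def t(1) tile_def prod.case
      by (intro conjI measure_chart_domain_prod *[OF t(2)] *[OF t(3)])
    also have "(real (i + 1) / n - real i / n) * (real (j + 1) / n - real j / n) = 1 / (real n)\<^sup>2"
      using n by (simp add: field_simps power2_eq_square)
    finally show ?thesis .
  qed
  have fin: "finite T"
    using T by (rule finite_subset) auto
  have disj: "disjoint_family_on X T"
    using tile_disjoint[OF n] by (force simp: disjoint_family_on_def X_def)
  have "measure lebesgue (\<Union>t\<in>T. X t) = (\<Sum>t\<in>T. measure lebesgue (X t))"
    by (rule measure_finite_Union[OF fin _ disj]) (use X in \<open>auto dest: fmeasurableD fmeasurableD2\<close>)
  also have "\<dots> = (\<Sum>t\<in>T. 1 / (real n)\<^sup>2)"
    using X by (intro sum.cong) blast+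
  finally have "real (card T) / (real n)\<^sup>2 = measure lebesgue (\<Union>t\<in>T. X t)"
    by simp
  also have "\<dots> \<le> measure sphere_measure A"
  proof (rule measure_lambert_ge[OF A, where U = "\<Union>(i, j)\<in>T. tile n i j"])
    show "(\<Union>t\<in>T. X t) \<in> lmeasurable"
      using X fin by (intro fmeasurable.finite_UN) auto
  qed (use sub in \<open>force simp: X_def\<close>)+
  finally show ?thesis
    using n by (simp add: field_simps)
qed

section \<open>Discrepancy of one sample point per tile\<close>

lemma spherical_cap_halfspace:
  assumes "A \<in> spherical_caps"
  obtains w c where "A = {x \<in> sphere 0 1. c \<le> w \<bullet> x}"
proof -
  obtain w :: "real^3" and t where w: "norm w = 1" and t: "0 < t" and A: "A = {x \<in> sphere 0 1. dist w x \<le> t}"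
    using assms by (auto simp: spherical_caps_def)
  have "dist w x \<le> t \<longleftrightarrow> 1 - t\<^sup>2 / 2 \<le> w \<bullet> x" if "norm x = 1" for x
  proof -
    have "(dist w x)\<^sup>2 = 2 - 2 * (w \<bullet> x)"
      using w that by (simp add: dist_norm power2_norm_eq_inner inner_diff_left inner_diff_right
          inner_commute norm_eq_1)
    moreover have "dist w x \<le> t \<longleftrightarrow> (dist w x)\<^sup>2 \<le> t\<^sup>2"
      using t by (simp add: power_mono_iff)
    ultimately show ?thesis
      by auto
  qed
  then show ?thesis
    by (intro that[of "1 - t\<^sup>2 / 2" w]) (auto simp: A)
qed

text \<open>
  Both the number of sample points in \<open>A\<close> and \<open>n\<^sup>2\<close> times the measure of \<open>A\<close> lie between the number of
  tiles inside the preimage of \<open>A\<close> and the number of tiles that are inside or cut.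
\<close>

lemma tile_sample_discrepancy:
  assumes A: "A \<in> spherical_caps" and n: "n > 0" and I: "finite I" "card I = n\<^sup>2"
    and q: "q ` I \<subseteq> unit_square"
    and hit: "\<And>i j. i < n \<Longrightarrow> j < n \<Longrightarrow> \<exists>t\<in>I. q t \<in> tile n i j"
  shows "\<bar>(\<Sum>t\<in>I. indicator A (lambert (q t))) - (real n)\<^sup>2 * measure sphere_measure A\<bar> \<le> 4 * real n"
proof -
  obtain w c where A_eq: "A = {x \<in> sphere 0 1. c \<le> w \<bullet> x}"
    using spherical_cap_halfspace[OF A] .
  define S where "S = halfspace_preimage w c"
  have mem: "lambert p \<in> A \<longleftrightarrow> p \<in> S" if "p \<in> unit_square" for p
    using that by (cases p) (auto simp: A_eq S_def halfspace_preimage_def norm_lambert unit_square_def)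
  have "closed A"
  proof -
    have "A = sphere 0 1 \<inter> {x. c \<le> w \<bullet> x}"
      by (auto simp: A_eq)
    then show ?thesis
      by (auto intro!: closed_Int closed_Collect_le continuous_intros)
  qed
  then have borel: "A \<in> sets borel"
    by (rule borel_closed)
  let ?Q = "{..<n} \<times> {..<n}"
  define T where "T = (\<lambda>(i, j). tile n i j)"
  define inside outside cut where "inside = {p \<in> ?Q. T p \<subseteq> S}" and "outside = {p \<in> ?Q. T p \<subseteq> - S}"
    and "cut = {p \<in> ?Q. splits S (T p)}"
  \<comment> \<open>Since there are as many sample points as tiles, choosing one in each tile uses up all of them.\<close>
  have "\<forall>p\<in>?Q. \<exists>t. t \<in> I \<and> q t \<in> T p"
    using hit by (fastforce simp: T_def)
  then obtain g where g: "\<And>p. p \<in> ?Q \<Longrightarrow> g p \<in> I" "\<And>p. p \<in> ?Q \<Longrightarrow> q (g p) \<in> T p"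
    by (metis bchoice)
  have inj: "inj_on g ?Q"
  proof (rule inj_onI)
    fix p p' assume "p \<in> ?Q" "p' \<in> ?Q" "g p = g p'"
    then have "q (g p) \<in> T p" "q (g p) \<in> T p'"
      using g(2)[of p] g(2)[of p'] by auto
    then show "p = p'"
      using tile_disjoint[OF n] by (cases p; cases p') (auto simp: T_def)
  qed
  have "g ` ?Q = I"
    using g(1) I by (intro card_subset_eq) (auto simp: card_image[OF inj] power2_eq_square)
  then have "(\<Sum>t\<in>I. indicator A (lambert (q t))) = (\<Sum>p\<in>?Q. indicator A (lambert (q (g p))) :: real)"
    using sum.reindex[OF inj, of "\<lambda>t. indicator A (lambert (q t)) :: real"] by simp
  also have "\<dots> = (\<Sum>p\<in>?Q. indicator S (q (g p)))"
  proof (rule sum.cong[OF refl])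
    fix p assume "p \<in> ?Q"
    then have "q (g p) \<in> unit_square"
      using q g(1) by blast
    then show "indicator A (lambert (q (g p))) = (indicator S (q (g p)) :: real)"
      using mem by (simp add: indicator_def)
  qed
  finally have count: "(\<Sum>t\<in>I. indicator A (lambert (q t))) = (\<Sum>p\<in>?Q. indicator S (q (g p)) :: real)" .
  have "inside \<inter> outside = {}"
    using g(2) unfolding inside_def outside_def by blast
  moreover have "(inside \<union> outside) \<inter> cut = {}"
    unfolding inside_def outside_def cut_def splits_def by blast
  ultimately have disj: "inside \<inter> outside = {}" "(inside \<union> outside) \<inter> cut = {}" .
  have union: "?Q = inside \<union> outside \<union> cut"
    unfolding inside_def outside_def cut_def splits_def by blast
  have fin: "finite inside" "finite outside" "finite cut"
    unfolding inside_def outside_def cut_def by simp_all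
  have decomp: "sum f ?Q = sum f inside + sum f outside + sum f cut" for f :: "nat \<times> nat \<Rightarrow> real"
    unfolding union using disj fin by (simp add: sum.union_disjoint)
  have total: "(real n)\<^sup>2 = real (card inside) + real (card outside) + real (card cut)"
    using decomp[of "\<lambda>_. 1"] by (simp add: power2_eq_square)
  have "(\<Sum>p\<in>inside. indicator S (q (g p)) :: real) = (\<Sum>p\<in>inside. 1)"
    using g(2) unfolding inside_def by (intro sum.cong refl indicator_simps) blast
  moreover have "(\<Sum>p\<in>outside. indicator S (q (g p)) :: real) = (\<Sum>p\<in>outside. 0)"
    using g(2) unfolding outside_def by (intro sum.cong refl indicator_simps) blast
  moreover have "0 \<le> (\<Sum>p\<in>cut. indicator S (q (g p)) :: real)"
    by (intro sum_nonneg) auto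
  moreover have "(\<Sum>p\<in>cut. indicator S (q (g p)) :: real) \<le> (\<Sum>p\<in>cut. 1)"
    by (intro sum_mono) (auto simp: indicator_def)
  ultimately have points: "real (card inside) \<le> (\<Sum>p\<in>?Q. indicator S (q (g p)))"
    "(\<Sum>p\<in>?Q. indicator S (q (g p))) \<le> real (card inside) + real (card cut)"
    unfolding decomp by simp_all
  have lower: "real (card inside) \<le> (real n)\<^sup>2 * measure sphere_measure A"
  proof (rule card_tiles_le_measure[OF borel n])
    show "lambert ` tile n i j \<subseteq> A" if "(i, j) \<in> inside" for i j
      using that mem tile_subset_unit_square[of i n j] by (auto simp: inside_def T_def)
  qed (auto simp: inside_def)
  have "real (card outside) \<le> (real n)\<^sup>2 * measure sphere_measure (sphere 0 1 - A)"
  proof (rule card_tiles_le_measure[OF _ n])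
    show "lambert ` tile n i j \<subseteq> sphere 0 1 - A" if "(i, j) \<in> outside" for i j
    proof -
      have "lambert p \<in> sphere 0 1 - A" if "p \<in> tile n i j" for p
      proof -
        have "p \<in> unit_square" "p \<notin> S"
          using that \<open>(i, j) \<in> outside\<close> tile_subset_unit_square[of i n j] by (auto simp: outside_def T_def)
        then show ?thesis
          using mem by (cases p) (auto simp: unit_square_def norm_lambert)
      qed
      then show ?thesis
        by blast
    qed
    show "sphere 0 1 - A \<in> sets borel"
      using borel by (intro sets.Diff) auto
  qed (auto simp: outside_def)
  also have "measure sphere_measure (sphere 0 1 - A) = 1 - measure sphere_measure A"
  proof -
    have "emeasure sphere_measure (sphere 0 1) \<noteq> \<infinity>"
      using measure_sphere_measure_sphere by (auto simp: measure_def)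
    moreover have "A \<subseteq> sphere 0 1"
      by (auto simp: A_eq)
    ultimately show ?thesis
      using borel measure_sphere_measure_sphere by (subst measure_Diff) auto
  qed
  finally have upper: "(real n)\<^sup>2 * measure sphere_measure A \<le> real (card inside) + real (card cut)"
    using total by (simp add: algebra_simps)
  have cut_eq: "cut = {(i, j) \<in> ?Q. splits S (tile n i j)}"
    by (auto simp: cut_def T_def)
  have "card cut \<le> 4 * n"
    unfolding cut_eq S_def
    by (intro card_split_tiles_le halfspace_preimage_not_alternates halfspace_preimage_column)
  then have "real (card cut) \<le> 4 * real n"
    by linarith
  then show ?thesis
    unfolding count using points lower upper by linarith
qed

section \<open>Aligned blocks of guided sequences\<close>

lemma mem_cell_iff:
  assumes "b > 0"
  shows "(x, y) \<in> cell b m (u, v) \<longleftrightarrow> x \<in> {u..<u + 1 / real b ^ m} \<and> y \<in> {v..<v + 1 / real b ^ m}"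
proof
  assume "(x, y) \<in> cell b m (u, v)"
  then show "x \<in> {u..<u + 1 / real b ^ m} \<and> y \<in> {v..<v + 1 / real b ^ m}"
    using assms by (auto simp: cell_def unit_square_def divide_strict_right_mono)
next
  assume *: "x \<in> {u..<u + 1 / real b ^ m} \<and> y \<in> {v..<v + 1 / real b ^ m}"
  show "(x, y) \<in> cell b m (u, v)"
    unfolding cell_def
  proof (rule image_eqI)
    show "(x, y) = (u, v) + (1 / real b ^ m) *\<^sub>R (real b ^ m * (x - u), real b ^ m * (y - v))"
      using assms by simp
    show "(real b ^ m * (x - u), real b ^ m * (y - v)) \<in> unit_square"
      using assms * by (auto simp: unit_square_def field_simps)
  qed
qed

lemma cell_grid_point_eq_tile:
  assumes "b > 0"
  shows "cell b m (real i / real b ^ m, real j / real b ^ m) = tile (b ^ m) i j"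
  using assms by (auto simp: mem_cell_iff tile_def add_divide_distrib)

lemma cell_digit_subset:
  assumes "b > 0" "h \<in> digit_vectors b"
  shows "cell b (Suc m) ((1 / real b ^ Suc m) *\<^sub>R h + v) \<subseteq> cell b m v"
proof -
  obtain i j where h: "h = (real i, real j)" "i < b" "j < b"
    using assms(2) by (auto simp: digit_vectors_def)
  have *: "real k / real b ^ Suc m + 1 / real b ^ Suc m \<le> 1 / real b ^ m" if "k < b" for k
  proof -
    have "real k + 1 \<le> real b"
      using that by linarith
    then have "(real k + 1) * real b ^ m \<le> real b * real b ^ m"
      by (intro mult_right_mono) auto
    then show ?thesis
      using assms(1) by (simp add: field_simps)
  qed
  obtain v1 v2 where v: "v = (v1, v2)"
    by fastforce
  show ?thesis
  proof
    fix p assume "p \<in> cell b (Suc m) ((1 / real b ^ Suc m) *\<^sub>R h + v)"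
    then have "p \<in> cell b (Suc m) (real i / real b ^ Suc m + v1, real j / real b ^ Suc m + v2)"
      by (simp add: h v)
    moreover have "0 \<le> real i / real b ^ Suc m" "0 \<le> real j / real b ^ Suc m"
      by simp_all
    ultimately show "p \<in> cell b m v"
      using *[OF h(2)] *[OF h(3)] unfolding v
      by (cases p) (simp only: mem_cell_iff[OF assms(1)] atLeastLessThan_iff, linarith)
  qed
qed

lemma box_sequence_step:
  assumes "box_sequence b s" "1 \<le> k" "k < b\<^sup>2"
  obtains h where "h \<in> digit_vectors b"
    "\<And>i. i < b ^ (2 * m) \<Longrightarrow> s (k * b ^ (2 * m) + i) = (1 / real b ^ Suc m) *\<^sub>R h + s i"
proof -
  obtain H and p :: "nat \<Rightarrow> nat \<Rightarrow> nat" where H: "bij_betw H {1..b\<^sup>2 - 1} (digit_vectors b - {0})"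
    and p: "p m permutes {1..b\<^sup>2 - 1}"
    and s: "\<forall>k\<in>{1..b\<^sup>2 - 1}. \<forall>i<b ^ (2 * m). s (k * b ^ (2 * m) + i) = (1 / real b ^ (m + 1)) *\<^sub>R H (p m k) + s i"
    using assms(1) unfolding box_sequence_def by metis
  have k: "k \<in> {1..b\<^sup>2 - 1}"
    using assms by auto
  then have "H (p m k) \<in> digit_vectors b"
    using permutes_in_image[OF p, of k] bij_betwE[OF H] by auto
  then show ?thesis
    using s k by (intro that[of "H (p m k)"]) auto
qed

lemma box_sequence_digit:
  assumes "box_sequence b s" "h \<in> digit_vectors b" "h \<noteq> 0"
  obtains k where "1 \<le> k" "k < b\<^sup>2"
    "\<And>i. i < b ^ (2 * m) \<Longrightarrow> s (k * b ^ (2 * m) + i) = (1 / real b ^ Suc m) *\<^sub>R h + s i"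
proof -
  obtain H and p :: "nat \<Rightarrow> nat \<Rightarrow> nat" where H: "bij_betw H {1..b\<^sup>2 - 1} (digit_vectors b - {0})"
    and p: "p m permutes {1..b\<^sup>2 - 1}"
    and s: "\<forall>k\<in>{1..b\<^sup>2 - 1}. \<forall>i<b ^ (2 * m). s (k * b ^ (2 * m) + i) = (1 / real b ^ (m + 1)) *\<^sub>R H (p m k) + s i"
    using assms(1) unfolding box_sequence_def by metis
  have "h \<in> H ` p m ` {1..b\<^sup>2 - 1}"
    using assms bij_betw_imp_surj_on[OF H] permutes_image[OF p] by auto
  then obtain k where k: "k \<in> {1..b\<^sup>2 - 1}" "h = H (p m k)"
    by blast
  then show ?thesis
    using s by (intro that[of k]) auto
qed

text \<open>
  Splitting both coordinates into the last base \<open>b\<close> digit and the rest turns a point of the fine grid into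
  a digit vector plus a point of the coarser grid, which is how the sequence is built.
\<close>

lemma box_sequence_hits_grid:
  assumes "b > 1" "box_sequence b s" "i < b ^ m" "j < b ^ m"
  shows "\<exists>r < b ^ (2 * m). s r = (real i / real b ^ m, real j / real b ^ m)"
  using assms(3,4)
proof (induction m arbitrary: i j)
  case 0
  then show ?case
    using assms(2) by (auto simp: box_sequence_def zero_prod_def)
next
  case (Suc m)
  have "i div b < b ^ m" "j div b < b ^ m"
    using Suc.prems by (auto simp: less_mult_imp_div_less mult.commute)
  then obtain r where r: "r < b ^ (2 * m)" "s r = (real (i div b) / real b ^ m, real (j div b) / real b ^ m)"
    using Suc.IH by blast
  define h where "h = (real (i mod b), real (j mod b))"
  have h: "h \<in> digit_vectors b"
    using assms(1) by (auto simp: h_def digit_vectors_def)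
  have coord: "real k / real b ^ Suc m = real (k mod b) / real b ^ Suc m + real (k div b) / real b ^ m" for k
  proof -
    have "real k = real (k div b) * real b + real (k mod b)"
      by (simp flip: of_nat_mult of_nat_add)
    then show ?thesis
      using assms(1) by (simp add: field_simps)
  qed
  have point: "(real i / real b ^ Suc m, real j / real b ^ Suc m) = (1 / real b ^ Suc m) *\<^sub>R h + s r"
    by (simp add: r(2) h_def coord[of i] coord[of j] del: power_Suc)
  show ?case
  proof (cases "h = 0")
    case True
    have "b ^ (2 * m) \<le> b ^ (2 * Suc m)"
      using assms(1) by (intro power_increasing) auto
    with r(1) have "r < b ^ (2 * Suc m)"
      by (rule less_le_trans)
    then show ?thesis
      using point True by (intro exI[of _ r] conjI) (simp_all del: power_Suc)
  next
    case False
    obtain k where k: "1 \<le> k" "k < b\<^sup>2"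
      "s (k * b ^ (2 * m) + r) = (1 / real b ^ Suc m) *\<^sub>R h + s r"
      using box_sequence_digit[OF assms(2) h False, of m] r(1) by metis
    have "k * b ^ (2 * m) + r < (k + 1) * b ^ (2 * m)"
      using r(1) by simp
    also have "\<dots> \<le> b\<^sup>2 * b ^ (2 * m)"
      using k(2) by (intro mult_right_mono) auto
    also have "\<dots> = b ^ (2 * Suc m)"
      by (simp add: power2_eq_square mult.assoc)
    finally show ?thesis
      using k(3) point by (intro exI[of _ "k * b ^ (2 * m) + r"]) auto
  qed
qed

text \<open>
  Removing the leading base \<open>b\<^sup>2\<close> digit of the index moves to the surrounding cell of the next coarser
  level; doing so repeatedly leaves the remainder modulo \<open>b ^ (2 * m)\<close>.
\<close>

lemma box_sequence_cells_nested:
  assumes "b > 1" "box_sequence b s" "m \<le> M" "t < b ^ (2 * M)"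
  shows "cell b M (s t) \<subseteq> cell b m (s (t mod b ^ (2 * m)))"
  using assms(3,4)
proof (induction M arbitrary: t rule: dec_induct)
  case (step M)
  define k r where "k = t div b ^ (2 * M)" and "r = t mod b ^ (2 * M)"
  have pos: "0 < b ^ (2 * M)"
    using assms(1) by simp
  have t: "t = k * b ^ (2 * M) + r" "r < b ^ (2 * M)"
    using pos by (simp_all add: k_def r_def div_mult_mod_eq)
  have k: "k < b\<^sup>2"
    using step.prems by (auto simp: k_def power2_eq_square mult.assoc less_mult_imp_div_less)
  have "b ^ (2 * m) dvd b ^ (2 * M)"
    using step.hyps by (intro le_imp_power_dvd) auto
  then have "r mod b ^ (2 * m) = t mod b ^ (2 * m)"
    by (simp add: r_def mod_mod_cancel)
  then have sub: "cell b M (s r) \<subseteq> cell b m (s (t mod b ^ (2 * m)))"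
    using step.IH[OF t(2)] by simp
  obtain h where h: "h \<in> digit_vectors b" "s t = (1 / real b ^ Suc M) *\<^sub>R h + s r"
  proof (cases "k = 0")
    case True
    have "(0, 0) \<in> digit_vectors b"
      using assms(1) by (auto simp: digit_vectors_def intro!: exI[of _ 0])
    then show ?thesis
      using that[of 0] t True by (simp add: zero_prod_def)
  next
    case False
    then show ?thesis
      using box_sequence_step[OF assms(2) _ k, of M] t that by (metis One_nat_def Suc_leI not_gr_zero)
  qed
  have "cell b (Suc M) (s t) \<subseteq> cell b M (s r)"
    unfolding h(2) using assms(1) h(1) by (intro cell_digit_subset) auto
  then show ?case
    using sub by blast
qed simp

text \<open>
  For \<open>a = 0\<close> this is the first condition on guided sequences. For \<open>a > 0\<close> let \<open>M\<close> be the position of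
  the leading base \<open>b\<^sup>2\<close> digit of the index \<open>t\<close>, so that \<open>m \<le> M\<close>: the second condition places \<open>q t\<close> in a
  cell of level \<open>M\<close>, and nesting places this cell in the tile belonging to \<open>t mod b ^ (2 * m)\<close>.
\<close>

lemma guided_block_hits_tile:
  assumes b: "b > 1" and s: "box_sequence b s" and q: "guided_by b s q" and ij: "i < b ^ m" "j < b ^ m"
  shows "\<exists>t \<in> {a * b ^ (2 * m)..<(a + 1) * b ^ (2 * m)}. q t \<in> tile (b ^ m) i j"
proof (cases "a = 0")
  case True
  show ?thesis
  proof (cases m)
    case 0
    have "q 0 \<in> tile 1 0 0"
      using q by (simp add: guided_by_def tile_def unit_square_def)
    then show ?thesis
      using True 0 ij by simp
  next
    case (Suc m')
    have "(real k / real b ^ m) < 1" if "k < b ^ m" for k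
    proof -
      have "real k < real (b ^ m)"
        using that by (simp only: of_nat_less_iff)
      then show ?thesis
        using b by simp
    qed
    then have "(real i / real b ^ m, real j / real b ^ m) \<in> grid b m"
      using ij unfolding grid_def unit_square_def
      by (intro IntI CollectI exI[of _ "int i"] exI[of _ "int j"]) auto
    moreover have "\<forall>v\<in>grid b m. card (q ` {..<b ^ (2 * m)} \<inter> cell b m v) = 1"
      using q unfolding guided_by_def Suc Suc_eq_plus1 by blast
    ultimately have "card (q ` {..<b ^ (2 * m)} \<inter> tile (b ^ m) i j) = 1"
      using b cell_grid_point_eq_tile[of b m i j] by fastforce
    then obtain p where "p \<in> q ` {..<b ^ (2 * m)} \<inter> tile (b ^ m) i j"
      by (metis card.empty equals0I zero_neq_one)
    then show ?thesis
      using True by auto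
  qed
next
  case False
  obtain r where r: "r < b ^ (2 * m)" "s r = (real i / real b ^ m, real j / real b ^ m)"
    using box_sequence_hits_grid[OF b s ij] by blast
  define t where "t = a * b ^ (2 * m) + r"
  have large: "b ^ (2 * m) \<le> t"
    using False by (simp add: t_def trans_le_add1)
  have b2: "1 < b\<^sup>2"
    using one_less_power[OF b] by simp
  have "t > 0"
    using large b by (metis gr0I le_zero_eq not_one_less_zero power_not_zero)
  obtain M where M: "b\<^sup>2 ^ M \<le> t" "t < b\<^sup>2 ^ (M + 1)"
    using ex_power_ivl1[of "b\<^sup>2" t] b2 \<open>t > 0\<close> by auto
  then have M: "b ^ (2 * M) \<le> t" "t < b\<^sup>2 * b ^ (2 * M)"
    by (simp_all add: power_mult)
  have "m \<le> M"
  proof (rule ccontr)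
    assume "\<not> m \<le> M"
    then have "b ^ (2 * Suc M) \<le> b ^ (2 * m)"
      using b by (intro power_increasing) auto
    then show False
      using M(2) large by (simp add: power2_eq_square mult.assoc)
  qed
  define k c where "k = t div b ^ (2 * M)" and "c = t mod b ^ (2 * M)"
  have pos: "0 < b ^ (2 * M)"
    using b by simp
  have "1 \<le> k" "k < b\<^sup>2" "c < b ^ (2 * M)" "t = c + k * b ^ (2 * M)"
    using M pos by (auto simp: mod_div_mult_eq k_def c_def less_mult_imp_div_less Suc_le_eq div_greater_zero_iff)
  then have "q t \<in> cell b M (s c)"
    using q unfolding guided_by_def by blast
  also have "\<dots> \<subseteq> cell b m (s (c mod b ^ (2 * m)))"
    using box_sequence_cells_nested[OF b s \<open>m \<le> M\<close> \<open>c < b ^ (2 * M)\<close>] .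
  also have "c mod b ^ (2 * m) = r"
  proof -
    have "b ^ (2 * m) dvd b ^ (2 * M)"
      using \<open>m \<le> M\<close> by (intro le_imp_power_dvd) auto
    then show ?thesis
      using r(1) by (simp add: c_def t_def mod_mod_cancel)
  qed
  also have "cell b m (s r) = tile (b ^ m) i j"
    using b r(2) cell_grid_point_eq_tile[of b m i j] by simp
  finally show ?thesis
    using r(1) by (intro bexI[of _ t]) (auto simp: t_def)
qed

section \<open>Decomposing index intervals into aligned blocks\<close>

lemma abs_sum_aligned_blocks_le:
  fixes d :: "nat \<Rightarrow> real"
  assumes "\<And>a. \<bar>sum d {a * B..<(a + 1) * B}\<bar> \<le> K"
  shows "\<bar>sum d {a * B..<(a + c) * B}\<bar> \<le> real c * K"
proof (induction c)
  case (Suc c)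
  have "sum d {a * B..<(a + Suc c) * B}
      = sum d {a * B..<(a + c) * B} + sum d {(a + c) * B..<(a + c + 1) * B}"
    by (subst sum.atLeastLessThan_concat) auto
  then show ?case
    using Suc assms[of "a + c"] by (simp add: algebra_simps)
qed simp

text \<open>
  The offset \<open>a\<close> is kept arbitrary for the induction: after the blocks of the leading digit the remaining
  indices again start at a multiple of the next smaller block length.
\<close>

lemma abs_sum_digit_prefix_le:
  fixes d :: "nat \<Rightarrow> real"
  assumes "\<And>m a. \<bar>sum d {a * b ^ (2 * m)..<(a + 1) * b ^ (2 * m)}\<bar> \<le> K * real b ^ m"
  shows "\<bar>sum d {a * b ^ (2 * n)..<a * b ^ (2 * n) + (\<Sum>j<n. \<epsilon> j * b ^ (2 * j))}\<bar>
    \<le> K * (\<Sum>j<n. real (\<epsilon> j) * real b ^ j)"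
proof (induction n arbitrary: a)
  case (Suc n)
  let ?B = "b ^ (2 * n)" and ?R = "\<Sum>j<n. \<epsilon> j * b ^ (2 * j)"
  let ?a = "a * b\<^sup>2"
  have 1: "a * b ^ (2 * Suc n) = ?a * ?B"
    by (simp add: power2_eq_square)
  have 2: "?a * ?B + (\<Sum>j<Suc n. \<epsilon> j * b ^ (2 * j)) = (?a + \<epsilon> n) * ?B + ?R"
    by (simp add: algebra_simps)
  have "sum d {?a * ?B..<(?a + \<epsilon> n) * ?B + ?R}
      = sum d {?a * ?B..<(?a + \<epsilon> n) * ?B} + sum d {(?a + \<epsilon> n) * ?B..<(?a + \<epsilon> n) * ?B + ?R}"
    by (subst sum.atLeastLessThan_concat) auto
  then show ?case
    using abs_sum_aligned_blocks_le[where a = ?a and c = "\<epsilon> n", OF assms[of _ n]] Suc[of "?a + \<epsilon> n"]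
    unfolding 1 2 by (simp add: algebra_simps)
qed simp

lemma digit_sum_less:
  fixes b :: nat
  assumes "\<And>j. j < n \<Longrightarrow> \<epsilon> j < b\<^sup>2"
  shows "(\<Sum>j<n. \<epsilon> j * b ^ (2 * j)) < b ^ (2 * n)"
  using assms
proof (induction n)
  case (Suc n)
  have "(\<Sum>j<Suc n. \<epsilon> j * b ^ (2 * j)) < (\<epsilon> n + 1) * b ^ (2 * n)"
    using Suc by simp
  also have "\<dots> \<le> b\<^sup>2 * b ^ (2 * n)"
    using Suc.prems[of n] by (intro mult_right_mono) auto
  finally show ?case
    by (simp add: power2_eq_square mult.assoc)
qed simp

text \<open>
  The complementary decomposition. Reading upwards from the prefix, the rest of the block in which it ends is
  treated recursively, and \<open>b\<^sup>2 - 1 - \<epsilon> n\<close> full blocks of that length remain. The summand \<open>1\<close> stands for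
  the single index \<open>a\<close> that is left when all digits are used up.
\<close>

lemma abs_sum_digit_suffix_le:
  fixes d :: "nat \<Rightarrow> real"
  assumes "\<And>m a. \<bar>sum d {a * b ^ (2 * m)..<(a + 1) * b ^ (2 * m)}\<bar> \<le> K * real b ^ m"
    and "\<And>j. j < n \<Longrightarrow> \<epsilon> j < b\<^sup>2"
  shows "\<bar>sum d {a * b ^ (2 * n) + (\<Sum>j<n. \<epsilon> j * b ^ (2 * j))..<(a + 1) * b ^ (2 * n)}\<bar>
    \<le> K * (1 + (\<Sum>j<n. ((real b)\<^sup>2 - 1 - real (\<epsilon> j)) * real b ^ j))"
  using assms(2)
proof (induction n arbitrary: a)
  case 0
  then show ?case
    using assms(1)[of a 0] by simp
next
  case (Suc n)
  let ?B = "b ^ (2 * n)" and ?R = "\<Sum>j<n. \<epsilon> j * b ^ (2 * j)"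
  let ?a = "a * b\<^sup>2 + \<epsilon> n"
  define c where "c = b\<^sup>2 - 1 - \<epsilon> n"
  have c: "?a + 1 + c = (a + 1) * b\<^sup>2" "real c = (real b)\<^sup>2 - 1 - real (\<epsilon> n)"
  proof -
    have "\<epsilon> n + 1 + c = b\<^sup>2"
      using Suc.prems[of n] by (simp add: c_def)
    then show "?a + 1 + c = (a + 1) * b\<^sup>2"
      by simp
    have "real (\<epsilon> n + 1 + c) = (real b)\<^sup>2"
      unfolding \<open>\<epsilon> n + 1 + c = b\<^sup>2\<close> by simp
    then show "real c = (real b)\<^sup>2 - 1 - real (\<epsilon> n)"
      by simp
  qed
  have 1: "a * b ^ (2 * Suc n) + (\<Sum>j<Suc n. \<epsilon> j * b ^ (2 * j)) = ?a * ?B + ?R"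
    by (simp add: power2_eq_square algebra_simps)
  have 2: "(a + 1) * b ^ (2 * Suc n) = (?a + 1 + c) * ?B"
    unfolding c by (simp add: power2_eq_square algebra_simps)
  have "?R < ?B"
    using Suc.prems by (intro digit_sum_less) auto
  then have "sum d {?a * ?B + ?R..<(?a + 1 + c) * ?B}
      = sum d {?a * ?B + ?R..<(?a + 1) * ?B} + sum d {(?a + 1) * ?B..<(?a + 1 + c) * ?B}"
    by (subst sum.atLeastLessThan_concat) auto
  moreover have "\<bar>sum d {?a * ?B + ?R..<(?a + 1) * ?B}\<bar>
      \<le> K * (1 + (\<Sum>j<n. ((real b)\<^sup>2 - 1 - real (\<epsilon> j)) * real b ^ j))"
    using Suc.prems by (intro Suc.IH) auto
  moreover have "\<bar>sum d {(?a + 1) * ?B..<(?a + 1 + c) * ?B}\<bar> \<le> real c * (K * real b ^ n)"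
    using abs_sum_aligned_blocks_le[where a = "?a + 1" and c = c, OF assms(1)[of _ n]] .
  ultimately show ?case
    unfolding 1 2 c(2) by (simp add: algebra_simps)
qed

section \<open>The discrepancy of guided sequences\<close>

lemma spherical_caps_nonempty: "spherical_caps \<noteq> {}"
proof -
  have "diameter (sphere (0 :: real^3) 1) > 0"
  proof -
    have "dist (axis 1 1 :: real^3) (- axis 1 1) \<le> diameter (sphere (0 :: real^3) 1)"
      by (intro diameter_bounded_bound) auto
    moreover have "(axis 1 1 :: real^3) \<noteq> - axis 1 1"
      by (simp add: vec_eq_iff axis_def exI[of _ 1])
    ultimately show ?thesis
      by (smt (verit) dist_pos_lt)
  qed
  then obtain t where "0 < t" "t < diameter (sphere (0 :: real^3) 1)"
    using dense by blast
  then show ?thesis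
    unfolding spherical_caps_def by (auto intro!: exI[of _ "axis 1 1 :: real^3"] exI[of _ t])
qed

lemma cap_discrepancy_initial_le:
  assumes "N > 0"
    and "\<And>A. A \<in> spherical_caps \<Longrightarrow> \<bar>\<Sum>t<N. indicator A (Z t) - measure sphere_measure A\<bar> \<le> D"
  shows "cap_discrepancy (initial_mset Z N) \<le> D / real N"
proof -
  have size: "size (initial_mset Z N) = N"
    by (simp add: initial_mset_def)
  have "(SUP A\<in>spherical_caps. \<bar>(\<Sum>x\<in>#initial_mset Z N. indicator A x)
      - real (size (initial_mset Z N)) * measure sphere_measure A\<bar>) \<le> D"
  proof (rule cSUP_least[OF spherical_caps_nonempty])
    fix A :: "(real^3) set" assume "A \<in> spherical_caps"
    then have "\<bar>\<Sum>t<N. indicator A (Z t) - measure sphere_measure A\<bar> \<le> D"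
      by (rule assms(2))
    then show "\<bar>(\<Sum>x\<in>#initial_mset Z N. indicator A x)
        - real (size (initial_mset Z N)) * measure sphere_measure A\<bar> \<le> D"
      unfolding size
      by (simp add: initial_mset_def sum_subtractf sum_unfold_sum_mset image_mset.compositionality comp_def)
  qed
  then show ?thesis
    using assms(1) by (simp add: cap_discrepancy_def size divide_right_mono)
qed

lemma guided_block_discrepancy:
  assumes b: "b > 1" and s: "box_sequence b s" and q: "guided_by b s q" and A: "A \<in> spherical_caps"
  shows "\<bar>\<Sum>t = a * b ^ (2 * m)..<(a + 1) * b ^ (2 * m).
      indicator A (lambert (q t)) - measure sphere_measure A\<bar> \<le> 4 * real b ^ m"
proof -
  let ?I = "{a * b ^ (2 * m)..<(a + 1) * b ^ (2 * m)}"
  have card: "card ?I = (b ^ m)\<^sup>2"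
    by (simp add: power_mult[symmetric] mult.commute)
  have "\<bar>(\<Sum>t\<in>?I. indicator A (lambert (q t))) - (real (b ^ m))\<^sup>2 * measure sphere_measure A\<bar> \<le> 4 * real (b ^ m)"
  proof (rule tile_sample_discrepancy[OF A _ _ card])
    show "q ` ?I \<subseteq> unit_square"
      using q by (auto simp: guided_by_def)
    show "\<exists>t\<in>?I. q t \<in> tile (b ^ m) i j" if "i < b ^ m" "j < b ^ m" for i j
      using guided_block_hits_tile[OF b s q that] .
  qed (use b in auto)
  then show ?thesis
    by (simp only: sum_subtractf sum_constant card of_nat_power)
qed

text \<open>
  The first entry of the minimum comes from the blocks that make up the first \<open>N\<close> indices. For the second one,
  the first \<open>b ^ (2 * n + 2)\<close> indices are a single block with error at most \<open>4 * b ^ (n + 1)\<close>, and the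
  missing indices contribute at most four times \<open>\<Sum> (b\<^sup>2 - 1 - \<epsilon>\<^sub>j) b ^ j + 1\<close>, evaluated as a geometric
  sum.
\<close>

lemma guided_discrepancy:
  assumes b: "b > 1" and s: "box_sequence b s" and q: "guided_by b s q" and A: "A \<in> spherical_caps"
    and \<epsilon>: "\<And>j. j \<le> n \<Longrightarrow> \<epsilon> j < b\<^sup>2" and N: "N = (\<Sum>j=0..n. \<epsilon> j * b ^ (2 * j))"
  defines "\<Sigma> \<equiv> \<Sum>j=0..n. real (\<epsilon> j) * real b ^ j"
  shows "\<bar>\<Sum>t<N. indicator A (lambert (q t)) - measure sphere_measure A\<bar>
    \<le> 4 * min \<Sigma> (real b ^ (n + 1) * (real b + 2) - \<Sigma>)"
proof -
  define d where "d = (\<lambda>t. indicator A (lambert (q t)) - measure sphere_measure A)"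
  have block: "\<bar>sum d {a * b ^ (2 * m)..<(a + 1) * b ^ (2 * m)}\<bar> \<le> 4 * real b ^ m" for m a
    unfolding d_def by (rule guided_block_discrepancy[OF b s q A])
  have interval: "{0..n} = {..<Suc n}"
    by auto
  have less: "\<epsilon> j < b\<^sup>2" if "j < Suc n" for j
    using \<epsilon>[of j] that by simp
  have prefix: "\<bar>sum d {0..<N}\<bar> \<le> 4 * \<Sigma>"
    using abs_sum_digit_prefix_le[OF block, of 0 "Suc n" \<epsilon>]
    by (simp only: N \<Sigma>_def interval mult_zero_left add_0)
  have "N < b ^ (2 * Suc n)"
    unfolding N interval by (rule digit_sum_less[OF less])
  then have split: "sum d {0..<N} = sum d {0..<b ^ (2 * Suc n)} - sum d {N..<b ^ (2 * Suc n)}"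
    using sum.atLeastLessThan_concat[of 0 N "b ^ (2 * Suc n)" d] by simp
  have whole: "\<bar>sum d {0..<b ^ (2 * Suc n)}\<bar> \<le> 4 * real b ^ Suc n"
    using block[of 0 "Suc n"] by (simp only: mult_zero_left add_0 mult_1)
  have suffix: "\<bar>sum d {N..<b ^ (2 * Suc n)}\<bar>
      \<le> 4 * (1 + (\<Sum>j<Suc n. ((real b)\<^sup>2 - 1 - real (\<epsilon> j)) * real b ^ j))"
    using abs_sum_digit_suffix_le[where a = 0 and n = "Suc n" and \<epsilon> = \<epsilon>, OF block less]
    by (simp only: N interval mult_zero_left add_0 mult_1)
  have missing: "(\<Sum>j<Suc n. ((real b)\<^sup>2 - 1 - real (\<epsilon> j)) * real b ^ j) = (real b + 1) * (real b ^ Suc n - 1) - \<Sigma>"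
  proof -
    have "(\<Sum>j<Suc n. ((real b)\<^sup>2 - 1 - real (\<epsilon> j)) * real b ^ j)
        = ((real b)\<^sup>2 - 1) * (\<Sum>j<Suc n. real b ^ j) - \<Sigma>"
      unfolding \<Sigma>_def interval by (simp only: left_diff_distrib sum_subtractf sum_distrib_left)
    also have "((real b)\<^sup>2 - 1) * (\<Sum>j<Suc n. real b ^ j) = (real b + 1) * (real b ^ Suc n - 1)"
    proof -
      have "(real b)\<^sup>2 - 1 = (real b + 1) * (real b - 1)"
        by (simp add: power2_eq_square algebra_simps)
      then show ?thesis
        by (simp only: power_diff_1_eq mult.assoc)
    qed
    finally show ?thesis .
  qed
  have "\<bar>sum d {0..<N}\<bar> \<le> \<bar>sum d {0..<b ^ (2 * Suc n)}\<bar> + \<bar>sum d {N..<b ^ (2 * Suc n)}\<bar>"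
    unfolding split by (rule abs_triangle_ineq4)
  also have "\<dots> \<le> 4 * real b ^ Suc n + 4 * (1 + ((real b + 1) * (real b ^ Suc n - 1) - \<Sigma>))"
    by (rule add_mono[OF whole suffix[unfolded missing]])
  \<comment> \<open>The summand 1 for the last single index is absorbed by the term - (b + 1) of the geometric sum.\<close>
  also have "\<dots> \<le> 4 * (real b ^ (n + 1) * (real b + 2) - \<Sigma>)"
    by (simp add: algebra_simps)
  finally show ?thesis
    using prefix by (simp add: d_def min_def atLeast0LessThan)
qed

theorem theorem6:
  fixes b :: nat
  assumes "b > 1"
  shows "\<exists>C' :: real. \<forall>Z \<in> lambert_guided_sequences b. \<forall>(N :: nat) (n :: nat) (\<epsilon> :: nat \<Rightarrow> nat).
    N \<ge> 1 \<longrightarrow> (\<forall>j\<le>n. \<epsilon> j \<le> b\<^sup>2 - 1) \<longrightarrow> \<epsilon> n \<noteq> 0 \<longrightarrow> N = (\<Sum>j=0..n. \<epsilon> j * b ^ (2 * j)) \<longrightarrow>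
      cap_discrepancy (initial_mset Z N)
        \<le> (2 + 3 * sqrt 2) / real N *
            min (\<Sum>j=0..n. real (\<epsilon> j) * real b ^ j)
                (real b ^ (n + 1) * (real b + 2) - (\<Sum>j=0..n. real (\<epsilon> j) * real b ^ j))
          + C' / real N * ln (real N) \<and>
      (2 + 3 * sqrt 2) / real N *
            min (\<Sum>j=0..n. real (\<epsilon> j) * real b ^ j)
                (real b ^ (n + 1) * (real b + 2) - (\<Sum>j=0..n. real (\<epsilon> j) * real b ^ j))
          + C' / real N * ln (real N)
        \<le> (2 + 3 * sqrt 2) / 2 * (real b * (real b + 2) / sqrt (real N))
          + C' / real N * ln (real N)"
\<comment> \<open>The bound on the number of cut tiles has no lower-order term, hence the witness 0.\<close>
proof (intro exI[of _ 0] ballI allI impI)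
  fix Z :: "nat \<Rightarrow> real^3" and N n :: nat and \<epsilon> :: "nat \<Rightarrow> nat"
  assume Z: "Z \<in> lambert_guided_sequences b" and N1: "N \<ge> 1" and \<epsilon>: "\<forall>j\<le>n. \<epsilon> j \<le> b\<^sup>2 - 1"
    and \<epsilon>n: "\<epsilon> n \<noteq> 0" and N: "N = (\<Sum>j=0..n. \<epsilon> j * b ^ (2 * j))"
  define \<Sigma> where "\<Sigma> = (\<Sum>j=0..n. real (\<epsilon> j) * real b ^ j)"
  define M where "M = min \<Sigma> (real b ^ (n + 1) * (real b + 2) - \<Sigma>)"
  obtain q s where q: "Z = lambert \<circ> q" "box_sequence b s" "guided_by b s q"
    using Z by (auto simp: lambert_guided_sequences_def)
  have less: "\<epsilon> j < b\<^sup>2" if "j \<le> n" for j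
  proof -
    have "0 < b\<^sup>2"
      using assms by simp
    then show ?thesis
      using \<epsilon> that by (metis Suc_diff_1 le_imp_less_Suc One_nat_def)
  qed
  have bound: "\<bar>\<Sum>t<N. indicator A (Z t) - measure sphere_measure A\<bar> \<le> 4 * M" if "A \<in> spherical_caps" for A
    using guided_discrepancy[OF assms q(2,3) that less N] by (simp add: q(1) M_def \<Sigma>_def)
  have "cap_discrepancy (initial_mset Z N) \<le> 4 * M / real N"
    using N1 bound by (intro cap_discrepancy_initial_le) auto
  moreover have "4 * M \<le> (2 + 3 * sqrt 2) * M"
  proof (rule mult_right_mono)
    have "1 \<le> sqrt 2"
      by simp
    then show "4 \<le> 2 + 3 * sqrt 2"
      by linarith
    obtain A where "A \<in> spherical_caps"
      using spherical_caps_nonempty by blast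
    then have "0 \<le> 4 * M"
      by (rule order_trans[OF abs_ge_zero bound])
    then show "0 \<le> M"
      by simp
  qed
  then have "4 * M / real N \<le> (2 + 3 * sqrt 2) * M / real N"
    by (intro divide_right_mono) auto
  ultimately have 1: "cap_discrepancy (initial_mset Z N) \<le> (2 + 3 * sqrt 2) / real N * M"
    by simp
  have "M \<le> real b ^ (n + 1) * (real b + 2) / 2"
    by (simp add: M_def min_def)
  also have "\<dots> \<le> sqrt (real N) * (real b * (real b + 2) / 2)"
  proof -
    have "b ^ (2 * n) \<le> \<epsilon> n * b ^ (2 * n)"
      using \<epsilon>n by simp
    also have "\<dots> \<le> N"
      unfolding N by (rule member_le_sum) auto
    finally have "(real b ^ n)\<^sup>2 \<le> real N"
      by (simp add: power_mult[symmetric] mult.commute flip: of_nat_power)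
    then have "real b ^ n \<le> sqrt (real N)"
      by (rule real_le_rsqrt)
    then have "real b ^ n * (real b * (real b + 2) / 2) \<le> sqrt (real N) * (real b * (real b + 2) / 2)"
      by (rule mult_right_mono) simp
    then show ?thesis
      by (simp add: mult_ac)
  qed
  finally have "M / real N \<le> sqrt (real N) * (real b * (real b + 2) / 2) / real N"
    by (rule divide_right_mono) simp
  also have "\<dots> = (real b * (real b + 2) / 2) * (sqrt (real N) / real N)"
    by simp
  also have "sqrt (real N) / real N = 1 / sqrt (real N)"
    using N1 by (simp add: divide_simps)
  also have "real b * (real b + 2) / 2 * (1 / sqrt (real N)) = real b * (real b + 2) / sqrt (real N) / 2"
    by simp
  finally have "(2 + 3 * sqrt 2) * (M / real N) \<le> (2 + 3 * sqrt 2) * (real b * (real b + 2) / sqrt (real N) / 2)"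
    by (rule mult_left_mono) simp
  then have 2: "(2 + 3 * sqrt 2) / real N * M \<le> (2 + 3 * sqrt 2) / 2 * (real b * (real b + 2) / sqrt (real N))"
    by simp
  show "cap_discrepancy (initial_mset Z N)
      \<le> (2 + 3 * sqrt 2) / real N *
          min (\<Sum>j=0..n. real (\<epsilon> j) * real b ^ j)
              (real b ^ (n + 1) * (real b + 2) - (\<Sum>j=0..n. real (\<epsilon> j) * real b ^ j))
        + 0 / real N * ln (real N) \<and>
    (2 + 3 * sqrt 2) / real N *
          min (\<Sum>j=0..n. real (\<epsilon> j) * real b ^ j)
              (real b ^ (n + 1) * (real b + 2) - (\<Sum>j=0..n. real (\<epsilon> j) * real b ^ j))
        + 0 / real N * ln (real N)
      \<le> (2 + 3 * sqrt 2) / 2 * (real b * (real b + 2) / sqrt (real N))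
        + 0 / real N * ln (real N)"
    using 1 2 by (simp add: M_def \<Sigma>_def)
qed

end
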